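(* Let $(M^n,g_t)$ be a $C^\infty$ family of closed Riemannian manifolds (with $M$ fixed and $t$ in an interval around $0$), and let $\varphi_t$ be eigenfunctions of $-\Delta_{g_t}+V_t$ with $\varphi_t\to\varphi_0$ in $C^\infty(M)$ as $t\to0$. If $0$ is a regular value of $\varphi_0$, then for all sufficiently small $|t|$, $0$ is a regular value of $\varphi_t$, the nodal hypersurface $\mathcal N(\varphi_t)$ is ambiently isotopic in $M$ to $\mathcal N(\varphi_0)$, and $$\nu(\varphi_t)=\nu(\varphi_0).$$
   Context: $(V_t)$ is a $C^\infty$ family of real potentials on $M$; $-\Delta_{g_t}$ is the positive semidefinite Laplace–Beltrami operator; eigenfunctions are real-valued. $\mathcal N(\varphi)=\{x\in M:\varphi(x)=0\}$, and $\nu(\varphi)$ is the number of connected components of $M\setminus\mathcal N(\varphi)$. *)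

theory Defs
  imports "HOL-Analysis.Analysis"
begin

section \<open>Smooth functions between Euclidean spaces\<close>

primrec iter_deriv ::
  "'a list \<Rightarrow> ('a::real_normed_vector \<Rightarrow> 'b::real_normed_vector) \<Rightarrow> 'a \<Rightarrow> 'b" where
  "iter_deriv [] f = f"
| "iter_deriv (v # vs) f = (\<lambda>x. frechet_derivative (iter_deriv vs f) (at x) v)"

text \<open>Used for open \<open>S\<close> only.  Differentiability of every iterated directional derivative
  entails that all of them are continuous, so this is the usual class of infinitely often
  differentiable maps.\<close>

definition smooth_on ::
  "'a::real_normed_vector set \<Rightarrow> ('a \<Rightarrow> 'b::real_normed_vector) \<Rightarrow> bool" where
  "smooth_on S f \<longleftrightarrow> (\<forall>vs. \<forall>x\<in>S. iter_deriv vs f differentiable at x)"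

definition partial_deriv :: "'n::finite \<Rightarrow> (real^'n \<Rightarrow> real) \<Rightarrow> real^'n \<Rightarrow> real" where
  "partial_deriv i f \<xi> = frechet_derivative f (at \<xi>) (axis i 1)"


section \<open>Closed manifolds\<close>

text \<open>The manifold is the whole type \<open>'m\<close>.  A chart is a pair of its domain and its
  coordinate map, whose values outside the domain are irrelevant.\<close>

type_synonym ('m, 'n) chart = "'m set \<times> ('m \<Rightarrow> real^'n)"

definition local_rep :: "('m, 'n::finite) chart \<Rightarrow> ('m \<Rightarrow> 'b) \<Rightarrow> real^'n \<Rightarrow> 'b" where
  "local_rep C f = f \<circ> inv_into (fst C) (snd C)"

definition smooth_atlas :: "('m::topological_space, 'n::finite) chart set \<Rightarrow> bool" where
  "smooth_atlas A \<longleftrightarrow>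
     (\<forall>(U, x)\<in>A. open U \<and> open (x ` U) \<and> homeomorphism U (x ` U) x (inv_into U x)) \<and>
     (\<Union>(U, x)\<in>A. U) = UNIV \<and>
     (\<forall>(U, x)\<in>A. \<forall>(V, y)\<in>A. smooth_on (x ` (U \<inter> V)) (local_rep (U, x) y))"

text \<open>Closed means compact without boundary.  Second countability need not be required:
  finitely many charts cover.\<close>

definition closed_manifold :: "('m::t2_space, 'n::finite) chart set \<Rightarrow> bool" where
  "closed_manifold A \<longleftrightarrow> smooth_atlas A \<and> compact (UNIV :: 'm set)"

definition smooth_fun :: "('m, 'n::finite) chart set \<Rightarrow> ('m \<Rightarrow> real) \<Rightarrow> bool" where
  "smooth_fun A f \<longleftrightarrow> (\<forall>(U, x)\<in>A. smooth_on (x ` U) (local_rep (U, x) f))"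

definition smooth_fun_family ::
  "('m, 'n::finite) chart set \<Rightarrow> real set \<Rightarrow> (real \<Rightarrow> 'm \<Rightarrow> real) \<Rightarrow> bool" where
  "smooth_fun_family A I f \<longleftrightarrow>
     (\<forall>(U, x)\<in>A. smooth_on (I \<times> x ` U) (\<lambda>(t, \<xi>). local_rep (U, x) (f t) \<xi>))"

definition smooth_map ::
  "('m::topological_space, 'n::finite) chart set \<Rightarrow> ('m \<Rightarrow> 'm) \<Rightarrow> bool" where
  "smooth_map A F \<longleftrightarrow> continuous_on UNIV F \<and>
     (\<forall>(U, x)\<in>A. \<forall>(V, y)\<in>A. smooth_on (x ` (U \<inter> F -` V)) (local_rep (U, x) (y \<circ> F)))"

definition smooth_map_family ::
  "('m::topological_space, 'n::finite) chart set \<Rightarrow> real set \<Rightarrow> (real \<Rightarrow> 'm \<Rightarrow> 'm) \<Rightarrow> bool" where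
  "smooth_map_family A J H \<longleftrightarrow> continuous_on (J \<times> UNIV) (\<lambda>(s, p). H s p) \<and>
     (\<forall>(U, x)\<in>A. \<forall>(V, y)\<in>A.
        smooth_on {(s, \<xi>). s \<in> J \<and> \<xi> \<in> x ` (U \<inter> H s -` V)}
          (\<lambda>(s, \<xi>). local_rep (U, x) (y \<circ> H s) \<xi>))"

definition diffeomorphism ::
  "('m::topological_space, 'n::finite) chart set \<Rightarrow> ('m \<Rightarrow> 'm) \<Rightarrow> bool" where
  "diffeomorphism A F \<longleftrightarrow> bij F \<and> smooth_map A F \<and> smooth_map A (inv F)"

text \<open>Smoothness of the isotopy up to the endpoints of the parameter interval is expressed by
  smoothness on an open neighbourhood of it.\<close>

definition ambiently_isotopic ::
  "('m::topological_space, 'n::finite) chart set \<Rightarrow> 'm set \<Rightarrow> 'm set \<Rightarrow> bool" where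
  "ambiently_isotopic A S T \<longleftrightarrow>
     (\<exists>J H. open J \<and> {0..1} \<subseteq> J \<and> smooth_map_family A J H \<and>
        (\<forall>s\<in>{0..1}. diffeomorphism A (H s)) \<and> H 0 = id \<and> H 1 ` S = T)"

definition regular_value ::
  "('m, 'n::finite) chart set \<Rightarrow> ('m \<Rightarrow> real) \<Rightarrow> real \<Rightarrow> bool" where
  "regular_value A f c \<longleftrightarrow>
     (\<forall>p. f p = c \<longrightarrow> (\<forall>(U, x)\<in>A. p \<in> U \<longrightarrow>
        surj (frechet_derivative (local_rep (U, x) f) (at (x p)))))"

text \<open>Convergence in the Frechet space of smooth functions: in every chart, all derivatives
  converge uniformly on compact sets.\<close>

definition smooth_convergence ::
  "('m, 'n::finite) chart set \<Rightarrow> ('i \<Rightarrow> 'm \<Rightarrow> real) \<Rightarrow> ('m \<Rightarrow> real) \<Rightarrow> 'i filter \<Rightarrow> bool" where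
  "smooth_convergence A f l F \<longleftrightarrow>
     (\<forall>(U, x)\<in>A. \<forall>K vs. compact K \<and> K \<subseteq> x ` U \<longrightarrow>
        uniform_limit K (\<lambda>t. iter_deriv vs (local_rep (U, x) (f t)))
          (iter_deriv vs (local_rep (U, x) l)) F)"


section \<open>Riemannian metrics and the Laplace--Beltrami operator\<close>

text \<open>A metric is given by its component matrices: \<open>g C p\<close> is the Gram matrix of the
  coordinate vector fields of the chart \<open>C\<close> at \<open>p\<close>.\<close>

type_synonym ('m, 'n) metric = "('m, 'n) chart \<Rightarrow> 'm \<Rightarrow> real^'n^'n"

definition riemannian_metric ::
  "('m, 'n::finite) chart set \<Rightarrow> ('m, 'n) metric \<Rightarrow> bool" where
  "riemannian_metric A g \<longleftrightarrow>
     (\<forall>(U, x)\<in>A. smooth_on (x ` U) (local_rep (U, x) (g (U, x))) \<and>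
        (\<forall>p\<in>U. transpose (g (U, x) p) = g (U, x) p \<and>
           (\<forall>v. v \<noteq> 0 \<longrightarrow> v \<bullet> (g (U, x) p *v v) > 0))) \<and>
     (\<forall>(U, x)\<in>A. \<forall>(V, y)\<in>A. \<forall>p\<in>U \<inter> V.
        let Jac = matrix (frechet_derivative (local_rep (U, x) y) (at (x p)))
        in g (U, x) p = transpose Jac ** g (V, y) p ** Jac)"

definition smooth_metric_family ::
  "('m, 'n::finite) chart set \<Rightarrow> real set \<Rightarrow> (real \<Rightarrow> ('m, 'n) metric) \<Rightarrow> bool" where
  "smooth_metric_family A I g \<longleftrightarrow>
     (\<forall>t\<in>I. riemannian_metric A (g t)) \<and>
     (\<forall>(U, x)\<in>A. smooth_on (I \<times> x ` U) (\<lambda>(t, \<xi>). local_rep (U, x) (g t (U, x)) \<xi>))"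

text \<open>The divergence of the gradient in the coordinates of a chart, so that
  \<open>- laplace_beltrami\<close> is the positive semidefinite operator.  The value at a point does not
  depend on the chart.\<close>

definition gradient ::
  "('m, 'n::finite) metric \<Rightarrow> ('m, 'n) chart \<Rightarrow> ('m \<Rightarrow> real) \<Rightarrow> real^'n \<Rightarrow> real^'n" where
  "gradient g C u \<xi> =
     matrix_inv (local_rep C (g C) \<xi>) *v (\<chi> j. partial_deriv j (local_rep C u) \<xi>)"

definition divergence ::
  "('m, 'n::finite) metric \<Rightarrow> ('m, 'n) chart \<Rightarrow> (real^'n \<Rightarrow> real^'n) \<Rightarrow> real^'n \<Rightarrow> real" where
  "divergence g C X \<xi> =
     (\<Sum>i\<in>UNIV. partial_deriv i (\<lambda>\<eta>. sqrt (det (local_rep C (g C) \<eta>)) * X \<eta> $ i) \<xi>)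
       / sqrt (det (local_rep C (g C) \<xi>))"

definition laplace_beltrami ::
  "('m, 'n::finite) metric \<Rightarrow> ('m, 'n) chart \<Rightarrow> ('m \<Rightarrow> real) \<Rightarrow> 'm \<Rightarrow> real" where
  "laplace_beltrami g C u p = divergence g C (gradient g C u) (snd C p)"

definition schroedinger_eigenfunction ::
  "('m, 'n::finite) chart set \<Rightarrow> ('m, 'n) metric \<Rightarrow> ('m \<Rightarrow> real) \<Rightarrow> ('m \<Rightarrow> real) \<Rightarrow> bool" where
  "schroedinger_eigenfunction A g V u \<longleftrightarrow>
     smooth_fun A u \<and> (\<exists>p. u p \<noteq> 0) \<and>
     (\<exists>\<mu>::real. \<forall>C\<in>A. \<forall>p\<in>fst C. - laplace_beltrami g C u p + V p * u p = \<mu> * u p)"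


section \<open>Nodal sets and nodal domains\<close>

definition nodal_set :: "('m \<Rightarrow> real) \<Rightarrow> 'm set" where
  "nodal_set u = {p. u p = 0}"

text \<open>Valued in \<^typ>\<open>enat\<close>, because \<^const>\<open>card\<close> is zero on infinite sets.\<close>

definition nodal_count :: "('m::topological_space \<Rightarrow> real) \<Rightarrow> enat" where
  "nodal_count u =
     (let D = components (- nodal_set u) in if finite D then enat (card D) else \<infinity>)"

end

theory Submission
  imports Defs
begin

text \<open>An ambient isotopy is built without integrating a vector field, by fragmentation.  Every point
  of \<open>M\<close> lies in a chart box on which either \<open>\<phi>\<^sub>0\<close> has no zero or some fixed directional derivative of
  \<open>\<phi>\<^sub>0\<close> is positive.  If \<open>\<rho>\<close> is a bump function supported in such a box and \<open>d\<close> is \<open>C\<^sup>1\<close>-small, then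
  the nodal sets of \<open>\<phi>\<^sub>0 + d\<close> and \<open>\<phi>\<^sub>0 + (1 - \<rho>) d\<close> are isotopic: in the first case they are equal, and
  in the second one slides each point of the box along the fixed direction until \<open>\<phi>\<^sub>0 + d - s \<rho> d\<close>
  takes the value that \<open>\<phi>\<^sub>0 + d\<close> had at the original point.  The slide is the identity wherever
  \<open>\<rho>\<close> vanishes, so it extends to \<open>M\<close>, and it is smooth by the scalar implicit function theorem.
  Finitely many bumps, each equal to \<open>1\<close> on its piece of a cover of \<open>M\<close>, turn \<open>d = \<phi>\<^sub>t - \<phi>\<^sub>0\<close> into
  \<open>0\<close>.\<close>

text \<open>Every map of an ambient isotopy must have a smooth inverse. Sliding back is the same
  construction with the two functions exchanged, so each box yields an inverse family along with the
  slide, and both are carried through all compositions. The smallness that a box demands depends on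
  the box, and after one bump the perturbation is no longer \<open>d\<close> but
  \<open>(1 - \<rho>) * d\<close>. A local correction is therefore formulated for every family that
  tends to zero in C^1 along a filter. Multiplication by a fixed smooth function preserves this
  class, so corrections chain without bookkeeping of constants. The bumps need not sum to 1:
  chaining multiplies \<open>d\<close> by the product of the factors \<open>1 - \<rho>\<close>,
  which vanishes wherever one bump equals 1. The isotopy has to be smooth on an open neighbourhood
  of [0,1]. The parameter runs over (-1,2), and the bound |s| \<le> 2 fixes the constants of the
  slide. Regularity and the nodal count come out of the same boxes: there the perturbed function has
  no zero or keeps a positive derivative, and the end map of the isotopy is a homeomorphism of
  \<open>M\<close>.\<close>

section \<open>Calculus of smooth maps\<close>

text \<open>The grading by order is needed because an implicit function gains its derivatives one at a time.\<close>

definition smooth_upto ::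
  "nat \<Rightarrow> 'a::real_normed_vector set \<Rightarrow> ('a \<Rightarrow> 'b::real_normed_vector) \<Rightarrow> bool" where
  "smooth_upto k S f \<longleftrightarrow>
     (\<forall>vs. length vs \<le> k \<longrightarrow> (\<forall>x\<in>S. iter_deriv vs f differentiable at x))"

lemma smooth_on_iff_upto: "smooth_on S f \<longleftrightarrow> (\<forall>k. smooth_upto k S f)"
  unfolding smooth_on_def smooth_upto_def by blast

text \<open>The head of the list is the derivative taken last, the final entry the one taken first.
  Splitting at the end lets an induction on the order pass from \<open>f\<close> to its directional
  derivatives.\<close>

lemma iter_deriv_snoc:
  "iter_deriv (vs @ [v]) f = iter_deriv vs (\<lambda>x. frechet_derivative f (at x) v)"
  by (induction vs) auto

lemma smooth_upto_0: "smooth_upto 0 S f \<longleftrightarrow> (\<forall>x\<in>S. f differentiable at x)"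
  unfolding smooth_upto_def by simp

lemma smooth_upto_Suc:
  "smooth_upto (Suc k) S f \<longleftrightarrow>
     (\<forall>x\<in>S. f differentiable at x) \<and> (\<forall>v. smooth_upto k S (\<lambda>x. frechet_derivative f (at x) v))"
  (is "?L \<longleftrightarrow> ?R")
proof
  assume L: ?L
  have "f differentiable at x" if "x \<in> S" for x
    using L[unfolded smooth_upto_def, rule_format, of "[]"] that by simp
  moreover have "smooth_upto k S (\<lambda>x. frechet_derivative f (at x) v)" for v
    unfolding smooth_upto_def
  proof (intro allI impI ballI)
    fix vs :: "'a list" and x assume "length vs \<le> k" "x \<in> S"
    then show "iter_deriv vs (\<lambda>x. frechet_derivative f (at x) v) differentiable at x"
      using L[unfolded smooth_upto_def, rule_format, of "vs @ [v]" x] by (simp add: iter_deriv_snoc)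
  qed
  ultimately show ?R by blast
next
  assume R: ?R
  show ?L unfolding smooth_upto_def
  proof (intro allI impI ballI)
    fix vs :: "'a list" and x assume *: "length vs \<le> Suc k" "x \<in> S"
    show "iter_deriv vs f differentiable at x"
    proof (cases vs rule: rev_cases)
      case Nil
      then show ?thesis using R * by simp
    next
      case (snoc ws w)
      have "smooth_upto k S (\<lambda>x. frechet_derivative f (at x) w)" using R by blast
      then show ?thesis using * snoc unfolding smooth_upto_def by (simp add: iter_deriv_snoc)
    qed
  qed
qed

text \<open>\<open>frechet_derivative\<close> is a choice from the set of derivatives at the point,
  and this set depends only on the germ. The equality thus holds even where no derivative
  exists.\<close>

lemma frechet_derivative_cong_open:
  assumes "open S" "x \<in> S" "\<And>y. y \<in> S \<Longrightarrow> f y = g y"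
  shows "frechet_derivative f (at x) = frechet_derivative g (at x)"
proof -
  have "(f has_derivative f') (at x) \<longleftrightarrow> (g has_derivative f') (at x)" for f'
    using assms has_derivative_transform_within_open[of _ f' x UNIV S] by metis
  then show ?thesis unfolding frechet_derivative_def by simp
qed

lemma differentiable_cong_open:
  assumes "open S" "x \<in> S" "\<And>y. y \<in> S \<Longrightarrow> f y = g y" "f differentiable at x"
  shows "g differentiable at x"
  using assms has_derivative_transform_within_open[of f _ x UNIV S g] unfolding differentiable_def
  by metis

lemma iter_deriv_cong_open:
  assumes "open S" "x \<in> S" "\<And>y. y \<in> S \<Longrightarrow> f y = g y"
  shows "iter_deriv vs f x = iter_deriv vs g x"
  using assms(2)
proof (induction vs arbitrary: x)
  case Nil
  then show ?case using assms(3) by simp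
next
  case (Cons v vs)
  have "frechet_derivative (iter_deriv vs f) (at x) = frechet_derivative (iter_deriv vs g) (at x)"
    by (rule frechet_derivative_cong_open[OF assms(1)]) (use Cons in auto)
  then show ?case by simp
qed

lemma smooth_upto_cong:
  assumes "open S" "\<And>y. y \<in> S \<Longrightarrow> f y = g y" "smooth_upto k S f"
  shows "smooth_upto k S g"
  unfolding smooth_upto_def
proof (intro allI impI ballI)
  fix vs :: "'a list" and x assume *: "length vs \<le> k" "x \<in> S"
  show "iter_deriv vs g differentiable at x"
    by (rule differentiable_cong_open[OF assms(1) *(2), of "iter_deriv vs f"])
       (use iter_deriv_cong_open[OF assms(1) _ assms(2)] assms(3) * in \<open>auto simp: smooth_upto_def\<close>)
qed

lemma smooth_on_cong:
  assumes "open S" "\<And>y. y \<in> S \<Longrightarrow> f y = g y" "smooth_on S f"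
  shows "smooth_on S g"
  using assms smooth_upto_cong unfolding smooth_on_iff_upto by blast

lemma smooth_on_subset: "smooth_on T f \<Longrightarrow> S \<subseteq> T \<Longrightarrow> smooth_on S f"
  unfolding smooth_on_def by blast

lemma smooth_on_locally:
  assumes "\<And>x. x \<in> S \<Longrightarrow> \<exists>N. open N \<and> x \<in> N \<and> smooth_on N f"
  shows "smooth_on S f"
  using assms unfolding smooth_on_def by blast

lemma smooth_upto_lessD: "smooth_upto (Suc k) S f \<Longrightarrow> smooth_upto k S f"
  unfolding smooth_upto_def by auto

lemma smooth_upto_differentiable: "smooth_upto k S f \<Longrightarrow> x \<in> S \<Longrightarrow> f differentiable at x"
  unfolding smooth_upto_def by (metis iter_deriv.simps(1) le0 list.size(3))

lemma smooth_upto_has_derivative: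
  "smooth_upto k S f \<Longrightarrow> x \<in> S \<Longrightarrow> (f has_derivative frechet_derivative f (at x)) (at x)"
  using smooth_upto_differentiable frechet_derivative_works by blast

lemma smooth_on_has_derivative:
  "smooth_on S f \<Longrightarrow> x \<in> S \<Longrightarrow> (f has_derivative frechet_derivative f (at x)) (at x)"
  using smooth_upto_has_derivative unfolding smooth_on_iff_upto by blast

lemma smooth_on_differentiable: "smooth_on S f \<Longrightarrow> x \<in> S \<Longrightarrow> f differentiable at x"
  using smooth_upto_differentiable unfolding smooth_on_iff_upto by blast

lemma smooth_on_isCont: "smooth_on S f \<Longrightarrow> x \<in> S \<Longrightarrow> isCont f x"
  using smooth_on_differentiable differentiable_imp_continuous_within by blast

lemma smooth_on_continuous_on: "smooth_on S f \<Longrightarrow> continuous_on S f"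
  by (metis continuous_at_imp_continuous_on differentiable_imp_continuous_within
      smooth_on_differentiable)

lemma smooth_on_deriv: "smooth_on S f \<Longrightarrow> smooth_on S (\<lambda>x. frechet_derivative f (at x) v)"
  unfolding smooth_on_iff_upto using smooth_upto_Suc by blast

lemma smooth_upto_deriv:
  "smooth_upto (Suc k) S f \<Longrightarrow> smooth_upto k S (\<lambda>x. frechet_derivative f (at x) v)"
  by (simp add: smooth_upto_Suc)

text \<open>The derivative may be given by any formula valid on \<open>S\<close>. Each closure
  property below then reduces to its differentiation rule and the induction hypothesis.\<close>

lemma smooth_upto_SucI:
  assumes "open S" "\<And>x. x \<in> S \<Longrightarrow> (f has_derivative f' x) (at x)"
    and "\<And>v. smooth_upto k S (\<lambda>x. f' x v)"
  shows "smooth_upto (Suc k) S f"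
  unfolding smooth_upto_Suc
proof (intro conjI ballI allI)
  show "f differentiable at x" if "x \<in> S" for x
    using assms(2) that differentiable_def by blast
  have "f' x = frechet_derivative f (at x)" if "x \<in> S" for x
    using assms(2)[OF that] frechet_derivative_at by blast
  then show "smooth_upto k S (\<lambda>x. frechet_derivative f (at x) v)" for v
    by (intro smooth_upto_cong[OF assms(1) _ assms(3)]) simp
qed

lemma smooth_upto_const [simp]: "open S \<Longrightarrow> smooth_upto k S (\<lambda>x. c)"
proof (induction k arbitrary: c)
  case (Suc k)
  then show ?case by (intro smooth_upto_SucI[where f' = "\<lambda>_ _. 0"]) auto
qed (simp add: smooth_upto_0)

lemma smooth_upto_bounded_linear:
  assumes "open S" "bounded_linear L"
  shows "smooth_upto k S L"
proof (cases k)
  case 0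
  then show ?thesis
    by (simp add: smooth_upto_0 assms(2) bounded_linear_imp_differentiable)
next
  case (Suc j)
  then show ?thesis
    using assms bounded_linear_imp_has_derivative smooth_upto_SucI[of S L "\<lambda>x. L" j] by auto
qed

lemma smooth_upto_add:
  assumes "open S" "smooth_upto k S f" "smooth_upto k S g"
  shows "smooth_upto k S (\<lambda>x. f x + g x)"
  using assms(2,3)
proof (induction k arbitrary: f g)
  case 0
  then show ?case by (auto simp: smooth_upto_0)
next
  case (Suc k)
  show ?case
    by (rule smooth_upto_SucI[OF assms(1) has_derivative_add])
       (use Suc in \<open>blast intro: smooth_upto_has_derivative smooth_upto_deriv\<close>)+
qed

lemma smooth_upto_sum:
  assumes "open S" "\<And>i. i \<in> B \<Longrightarrow> smooth_upto k S (f i)"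
  shows "smooth_upto k S (\<lambda>x. \<Sum>i\<in>B. f i x)"
  using assms(2)
proof (induction B rule: infinite_finite_induct)
  case (insert i B)
  then show ?case using smooth_upto_add[OF assms(1), of k "f i" "\<lambda>x. \<Sum>i\<in>B. f i x"] by simp
qed (use assms(1) in auto)

lemma smooth_upto_linear_image:
  assumes "open S" "bounded_linear L" "smooth_upto k S f"
  shows "smooth_upto k S (\<lambda>x. L (f x))"
  using assms(3)
proof (induction k arbitrary: f)
  case 0
  have "(\<lambda>x. L (f x)) differentiable at x" if "x \<in> S" for x
    using 0 that bounded_linear.has_derivative[OF assms(2)] unfolding smooth_upto_0 differentiable_def
    by blast
  then show ?case by (simp add: smooth_upto_0)
next
  case (Suc k)
  show ?case
    by (rule smooth_upto_SucI[OF assms(1) bounded_linear.has_derivative[OF assms(2)]])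
       (use Suc in \<open>blast intro: smooth_upto_has_derivative smooth_upto_deriv\<close>)+
qed

text \<open>The product rule turns the derivative into a sum of products of the same shape, with one
  factor differentiated and the other not; hence the induction generalises over both factors.
  Products, scalings and inner products are instances.\<close>

lemma smooth_upto_bilinear:
  assumes "open S" "bounded_bilinear m" "smooth_upto k S f" "smooth_upto k S g"
  shows "smooth_upto k S (\<lambda>x. m (f x) (g x))"
  using assms(3,4)
proof (induction k arbitrary: f g)
  case 0
  have "(\<lambda>x. m (f x) (g x)) differentiable at x" if "x \<in> S" for x
    using 0 that bounded_bilinear.FDERIV[OF assms(2)] unfolding smooth_upto_0 differentiable_def
    by blast
  then show ?case by (simp add: smooth_upto_0)
next
  case (Suc k)
  show ?case
  proof (rule smooth_upto_SucI[OF assms(1)])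
    show "((\<lambda>x. m (f x) (g x)) has_derivative (\<lambda>v. m (f x) (frechet_derivative g (at x) v) +
            m (frechet_derivative f (at x) v) (g x))) (at x)" if "x \<in> S" for x
      using that Suc.prems
      by (intro bounded_bilinear.FDERIV[OF assms(2)] smooth_upto_has_derivative)
    show "smooth_upto k S (\<lambda>x. m (f x) (frechet_derivative g (at x) v) +
            m (frechet_derivative f (at x) v) (g x))" for v
      by (intro smooth_upto_add assms(1) Suc.IH smooth_upto_deriv Suc.prems smooth_upto_lessD)
  qed
qed

lemma smooth_upto_Pair:
  assumes "open S" "smooth_upto k S f" "smooth_upto k S g"
  shows "smooth_upto k S (\<lambda>x. (f x, g x))"
  using assms(2,3)
proof (induction k arbitrary: f g)
  case 0
  have "(\<lambda>x. (f x, g x)) differentiable at x" if "x \<in> S" for x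
    using 0 that has_derivative_Pair unfolding smooth_upto_0 differentiable_def
    by blast
  then show ?case by (simp add: smooth_upto_0)
next
  case (Suc k)
  show ?case
    by (rule smooth_upto_SucI[OF assms(1) has_derivative_Pair])
       (use Suc in \<open>blast intro: smooth_upto_has_derivative smooth_upto_deriv\<close>)+
qed

lemma linear_Basis_expansion:
  fixes L :: "'b::euclidean_space \<Rightarrow> 'c::real_normed_vector"
  assumes "linear L"
  shows "L w = (\<Sum>b\<in>Basis. (w \<bullet> b) *\<^sub>R L b)"
  using linear_sum[OF assms, of "\<lambda>b. (w \<bullet> b) *\<^sub>R b" Basis] linear_scale[OF assms]
  by (simp add: euclidean_representation)

text \<open>Induction on the order by the chain rule. The outer derivative is composed with
  \<open>g\<close> again, so \<open>f\<close> varies in the induction while \<open>g\<close> stays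
  fixed.\<close>

lemma smooth_upto_compose:
  fixes f :: "'b::euclidean_space \<Rightarrow> 'c::real_normed_vector" and g :: "'a::real_normed_vector \<Rightarrow> 'b"
  assumes "open S" "open T" "g ` S \<subseteq> T" "smooth_upto k T f" "smooth_upto k S g"
  shows "smooth_upto k S (\<lambda>x. f (g x))"
  using assms(4,5)
proof (induction k arbitrary: f)
  case 0
  have "(\<lambda>x. f (g x)) differentiable at x" if "x \<in> S" for x
    using 0 that assms(3) has_derivative_compose[of g _ x UNIV f]
    unfolding smooth_upto_0 differentiable_def by blast
  then show ?case by (simp add: smooth_upto_0)
next
  case (Suc k)
  let ?F = "\<lambda>x. frechet_derivative f (at (g x))" and ?G = "\<lambda>x. frechet_derivative g (at x)"
  have F: "(f has_derivative ?F x) (at (g x))" if "x \<in> S" for x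
    using Suc.prems(1) assms(3) that by (blast intro: smooth_upto_has_derivative)
  show ?case
  proof (rule smooth_upto_SucI[OF assms(1)])
    fix x assume "x \<in> S"
    then show "((\<lambda>x. f (g x)) has_derivative (\<lambda>v. ?F x (?G x v))) (at x)"
      using F Suc.prems(2) by (intro has_derivative_compose[of g _ x UNIV f])
         (blast intro: smooth_upto_has_derivative)+
  next
    fix v
    \<comment> \<open>The direction \<open>?G x v\<close> moves with \<open>x\<close>, whereas the
      induction hypothesis speaks of derivatives of \<open>f\<close> in fixed directions. Expanding
      the direction in the basis separates the two dependences.\<close>
    have "smooth_upto k S (\<lambda>x. \<Sum>b\<in>Basis. (?G x v \<bullet> b) *\<^sub>R ?F x b)"
      by (intro smooth_upto_sum smooth_upto_bilinear[OF _ bounded_bilinear_scaleR]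
            smooth_upto_linear_image[OF _ bounded_linear_inner_left] Suc.IH assms(1)
            smooth_upto_deriv[OF Suc.prems(1)] smooth_upto_deriv[OF Suc.prems(2)]
            smooth_upto_lessD[OF Suc.prems(2)])
    then show "smooth_upto k S (\<lambda>x. ?F x (?G x v))"
      by (rule smooth_upto_cong[OF assms(1), rotated])
         (rule linear_Basis_expansion[OF has_derivative_linear[OF F], symmetric])
  qed
qed

text \<open>The derivative of the reciprocal contains the reciprocal itself, one order lower, so the
  order is raised step by step.\<close>

lemma smooth_upto_inverse:
  fixes f :: "'a::real_normed_vector \<Rightarrow> real"
  assumes "open S" "\<And>x. x \<in> S \<Longrightarrow> f x \<noteq> 0" "smooth_upto k S f"
  shows "smooth_upto k S (\<lambda>x. inverse (f x))"
  using assms(3)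
proof (induction k)
  case 0
  then show ?case using assms(2) by (auto simp: smooth_upto_0)
next
  case (Suc k)
  note S = Suc.IH[OF smooth_upto_lessD[OF Suc.prems]]
  show ?case
  proof (rule smooth_upto_SucI[OF assms(1)])
    fix x assume x: "x \<in> S"
    show "((\<lambda>x. inverse (f x)) has_derivative
        (\<lambda>v. - (inverse (f x) * frechet_derivative f (at x) v * inverse (f x)))) (at x)"
      by (rule Deriv.has_derivative_inverse[OF assms(2)[OF x] smooth_upto_has_derivative[OF Suc.prems x]])
  next
    fix v
    have D: "smooth_upto k S (\<lambda>x. frechet_derivative f (at x) v)"
      using Suc.prems smooth_upto_Suc by blast
    show "smooth_upto k S (\<lambda>x. - (inverse (f x) * frechet_derivative f (at x) v * inverse (f x)))"
      by (intro smooth_upto_linear_image[OF _ bounded_linear_minus[OF bounded_linear_ident]]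
            smooth_upto_bilinear[OF _ bounded_bilinear_mult] S D assms(1))
  qed
qed

section \<open>Closure properties in infinite order\<close>

lemma smooth_on_const [simp]: "open S \<Longrightarrow> smooth_on S (\<lambda>x. c)"
  by (simp add: smooth_on_iff_upto)

lemma smooth_on_bounded_linear: "open S \<Longrightarrow> bounded_linear L \<Longrightarrow> smooth_on S L"
  by (simp add: smooth_on_iff_upto smooth_upto_bounded_linear)

lemma smooth_on_add:
  "open S \<Longrightarrow> smooth_on S f \<Longrightarrow> smooth_on S g \<Longrightarrow> smooth_on S (\<lambda>x. f x + g x)"
  by (simp add: smooth_on_iff_upto smooth_upto_add)

lemma smooth_on_linear_image:
  "open S \<Longrightarrow> bounded_linear L \<Longrightarrow> smooth_on S f \<Longrightarrow> smooth_on S (\<lambda>x. L (f x))"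
  by (simp add: smooth_on_iff_upto smooth_upto_linear_image)

lemma smooth_on_minus: "open S \<Longrightarrow> smooth_on S f \<Longrightarrow> smooth_on S (\<lambda>x. - f x)"
  by (rule smooth_on_linear_image[OF _ bounded_linear_minus[OF bounded_linear_ident]])

lemma smooth_on_diff:
  "open S \<Longrightarrow> smooth_on S f \<Longrightarrow> smooth_on S g \<Longrightarrow> smooth_on S (\<lambda>x. f x - g x)"
  using smooth_on_add[of S f "\<lambda>x. - g x"] smooth_on_minus by auto

lemma smooth_on_bilinear:
  "open S \<Longrightarrow> bounded_bilinear m \<Longrightarrow> smooth_on S f \<Longrightarrow> smooth_on S g \<Longrightarrow>
    smooth_on S (\<lambda>x. m (f x) (g x))"
  by (simp add: smooth_on_iff_upto smooth_upto_bilinear)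

lemmas smooth_on_mult = smooth_on_bilinear[OF _ bounded_bilinear_mult]
lemmas smooth_on_scaleR = smooth_on_bilinear[OF _ bounded_bilinear_scaleR]
lemmas smooth_on_inner = smooth_on_bilinear[OF _ bounded_bilinear_inner]

lemma smooth_on_Pair:
  "open S \<Longrightarrow> smooth_on S f \<Longrightarrow> smooth_on S g \<Longrightarrow> smooth_on S (\<lambda>x. (f x, g x))"
  by (simp add: smooth_on_iff_upto smooth_upto_Pair)

lemma smooth_on_inverse:
  fixes f :: "'a::real_normed_vector \<Rightarrow> real"
  shows "open S \<Longrightarrow> (\<And>x. x \<in> S \<Longrightarrow> f x \<noteq> 0) \<Longrightarrow> smooth_on S f \<Longrightarrow> smooth_on S (\<lambda>x. inverse (f x))"
  by (simp add: smooth_on_iff_upto smooth_upto_inverse)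

lemma smooth_on_compose:
  fixes f :: "'b::euclidean_space \<Rightarrow> 'c::real_normed_vector"
  shows "open S \<Longrightarrow> open T \<Longrightarrow> (\<And>x. x \<in> S \<Longrightarrow> g x \<in> T) \<Longrightarrow> smooth_on T f \<Longrightarrow> smooth_on S g \<Longrightarrow>
    smooth_on S (\<lambda>x. f (g x))"
  unfolding smooth_on_iff_upto using smooth_upto_compose[of S T g _ f] by blast

lemma smooth_on_ident: "open S \<Longrightarrow> smooth_on S (\<lambda>x. x)"
  by (rule smooth_on_bounded_linear[OF _ bounded_linear_ident])

lemma smooth_on_fst: "open S \<Longrightarrow> smooth_on S fst"
  by (rule smooth_on_bounded_linear[OF _ bounded_linear_fst])

lemma smooth_on_snd: "open S \<Longrightarrow> smooth_on S snd"
  by (rule smooth_on_bounded_linear[OF _ bounded_linear_snd])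

section \<open>A scalar implicit function theorem\<close>

text \<open>Put w = y - z and k = h y - h z. Expanding \<open>\<Psi>\<close> along the graph gives
  that D (w, 0) + k b is small compared with |w| + |k|. As b is nonzero, the part in |k| can be
  absorbed on the left, so |k| = O(|w|), and the error becomes small compared with |w|.\<close>

lemma implicit_function_has_derivative:
  fixes \<Psi> :: "'a::real_normed_vector \<times> real \<Rightarrow> real" and h :: "'a \<Rightarrow> real"
  assumes D: "(\<Psi> has_derivative D) (at (z, h z))" and b: "D (0, 1) \<noteq> 0"
    and Z: "open Z" "z \<in> Z" and h: "isCont h z" and zero: "\<And>y. y \<in> Z \<Longrightarrow> \<Psi> (y, h y) = 0"
  shows "(h has_derivative (\<lambda>v. - D (v, 0) * inverse (D (0, 1)))) (at z)"
proof -
  interpret D: bounded_linear D using D by (rule has_derivative_bounded_linear)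
  define b where "b = D (0, 1)"
  have "b \<noteq> 0" using b by (simp add: b_def)
  have Dsplit: "D (w, k) = D (w, 0) + k * b" for w k
    using D.add[of "(w, 0)" "(0, k)"] D.scaleR[of k "(0, 1)"] by (simp add: b_def)
  obtain B where B: "B > 0" "\<And>w. norm (D w) \<le> norm w * B" using D.pos_bounded by blast
  have B': "\<bar>D (w, 0)\<bar> \<le> norm w * B" for w using B(2)[of "(w, 0)"] by (simp add: norm_Pair)
  \<comment> \<open>Absorbing half of |k| |b| leaves |k| \<le> (1 + 2 B / |b|) |w|, so
    \<open>C\<close> is the constant for which |w| + |k| \<le> C |w|.\<close>
  define C where "C = 2 + 2 * B / \<bar>b\<bar>"
  have "C > 0" using B(1) by (simp add: C_def add_pos_nonneg)
  have lin: "bounded_linear (\<lambda>v. - D (v, 0) * inverse b)"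
    by (intro bounded_linear_mult_const bounded_linear_minus
        bounded_linear_compose[OF D.bounded_linear_axioms])
       (intro bounded_linear_Pair bounded_linear_ident bounded_linear_zero)
  have "\<exists>d>0. \<forall>y. norm (y - z) < d \<longrightarrow>
          norm (h y - h z - (- D (y - z, 0) * inverse b)) \<le> \<epsilon> * norm (y - z)"
    if "\<epsilon> > 0" for \<epsilon>
  proof -
    \<comment> \<open>The first bound permits the absorption of |k|; the second turns e C |w| into
      an error of at most \<epsilon> |b| |w|, which is divided by |b| at the end.\<close>
    define e where "e = min (\<bar>b\<bar> / 2) (\<epsilon> * \<bar>b\<bar> / C)"
    have e: "e > 0" "e \<le> \<bar>b\<bar> / 2" "e * C \<le> \<epsilon> * \<bar>b\<bar>"
      using \<open>b \<noteq> 0\<close> \<open>C > 0\<close> that by (auto simp: e_def min_def field_simps)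
    obtain d where d: "d > 0"
      "\<And>y. norm (y - (z, h z)) < d \<Longrightarrow>
        norm (\<Psi> y - \<Psi> (z, h z) - D (y - (z, h z))) \<le> e * norm (y - (z, h z))"
      using D e(1) unfolding has_derivative_at_alt by metis
    have "((\<lambda>y. (y, h y)) \<longlongrightarrow> (z, h z)) (nhds z)"
      using h by (intro tendsto_Pair) (auto simp: isCont_def tendsto_nhds_iff filterlim_ident)
    then have "eventually (\<lambda>y. dist (y, h y) (z, h z) < d) (nhds z)"
      using d(1) tendstoD by blast
    moreover have "eventually (\<lambda>y. y \<in> Z) (nhds z)" using Z by (rule eventually_nhds_in_open)
    ultimately obtain d' where d': "d' > 0"
      "\<And>y. dist y z < d' \<Longrightarrow> dist (y, h y) (z, h z) < d \<and> y \<in> Z"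
      using eventually_conj eventually_nhds_metric by (smt (verit, best))
    have "norm (h y - h z - (- D (y - z, 0) * inverse b)) \<le> \<epsilon> * norm (y - z)"
      if "norm (y - z) < d'" for y
    proof -
      define w k where "w = y - z" and "k = h y - h z"
      have *: "dist (y, h y) (z, h z) < d" "y \<in> Z" using d'(2)[of y] that by (auto simp: dist_norm)
      have "norm (\<Psi> (y, h y) - \<Psi> (z, h z) - D (w, k)) \<le> e * norm (w, k)"
        using d(2)[of "(y, h y)"] * by (auto simp: dist_norm w_def k_def)
      then have "\<bar>D (w, 0) + k * b\<bar> \<le> e * norm (w, k)"
        using zero *(2) Z(2) Dsplit[of w k] by simp
      also have "\<dots> \<le> e * (norm w + \<bar>k\<bar>)"
        using e(1) norm_Pair_le[of w k] by (intro mult_left_mono) auto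
      finally have 1: "\<bar>D (w, 0) + k * b\<bar> \<le> e * (norm w + \<bar>k\<bar>)" .
      have "\<bar>k\<bar> * \<bar>b\<bar> \<le> \<bar>D (w, 0) + k * b\<bar> + \<bar>D (w, 0)\<bar>"
        by (simp add: abs_mult[symmetric])
      also have "\<dots> \<le> e * norm w + e * \<bar>k\<bar> + norm w * B"
        using 1 B'[of w] by (simp add: algebra_simps)
      also have "\<dots> \<le> \<bar>b\<bar> / 2 * norm w + \<bar>b\<bar> / 2 * \<bar>k\<bar> + norm w * B"
        using e(2) by (intro add_mono mult_right_mono order_refl) auto
      finally have "\<bar>k\<bar> * \<bar>b\<bar> \<le> (\<bar>b\<bar> + 2 * B) * norm w" by (simp add: algebra_simps)
      then have "\<bar>k\<bar> \<le> (C - 1) * norm w"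
        using \<open>b \<noteq> 0\<close> by (simp add: C_def field_simps)
      then have "e * (norm w + \<bar>k\<bar>) \<le> e * (C * norm w)"
        using e(1) by (intro mult_left_mono) (auto simp: algebra_simps)
      also have "\<dots> \<le> \<epsilon> * \<bar>b\<bar> * norm w"
        using e(3) by (metis mult.assoc mult_right_mono norm_ge_zero)
      finally have "\<bar>D (w, 0) + k * b\<bar> \<le> \<epsilon> * norm w * \<bar>b\<bar>"
        using 1 by (simp add: mult_ac)
      moreover have "k + D (w, 0) * inverse b = (D (w, 0) + k * b) / b"
        using \<open>b \<noteq> 0\<close> by (simp add: field_simps)
      ultimately show ?thesis
        using \<open>b \<noteq> 0\<close> by (simp add: w_def k_def divide_le_eq)
    qed
    then show ?thesis using d'(1) by blast
  qed
  then have "(h has_derivative (\<lambda>v. - D (v, 0) * inverse b)) (at z)"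
    unfolding has_derivative_at_alt using lin by blast
  then show ?thesis by (simp add: b_def)
qed

text \<open>A bootstrap: the derivative of \<open>h\<close> is an expression in the derivatives of
  \<open>\<Psi>\<close> evaluated on the graph of \<open>h\<close>. Hence smoothness of order k of
  \<open>h\<close> gives the same order for its derivative, that is, order k + 1 for
  \<open>h\<close>.\<close>

lemma implicit_function_smooth:
  fixes \<Psi> :: "'a::euclidean_space \<times> real \<Rightarrow> real" and h :: "'a \<Rightarrow> real"
  assumes Z: "open Z" and W: "open W" and \<Psi>: "smooth_on W \<Psi>" and h: "continuous_on Z h"
    and graph: "\<And>z. z \<in> Z \<Longrightarrow> (z, h z) \<in> W" "\<And>z. z \<in> Z \<Longrightarrow> \<Psi> (z, h z) = 0"
    and nz: "\<And>z. z \<in> Z \<Longrightarrow> frechet_derivative \<Psi> (at (z, h z)) (0, 1) \<noteq> 0"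
  shows "smooth_on Z h"
proof -
  have der: "(h has_derivative (\<lambda>v. - frechet_derivative \<Psi> (at (z, h z)) (v, 0) *
      inverse (frechet_derivative \<Psi> (at (z, h z)) (0, 1)))) (at z)" if "z \<in> Z" for z
  proof (rule implicit_function_has_derivative[where Z = Z])
    show "(\<Psi> has_derivative frechet_derivative \<Psi> (at (z, h z))) (at (z, h z))"
      using smooth_on_has_derivative[OF \<Psi> graph(1)[OF that]] .
    show "isCont h z" using h Z that continuous_on_eq_continuous_at by blast
  qed (use Z that graph nz in auto)
  have "smooth_upto k Z h" for k
  proof (induction k)
    case 0
    then show ?case using der by (auto simp: smooth_upto_0 differentiable_def)
  next
    case (Suc k)
    have D: "smooth_upto k Z (\<lambda>z. frechet_derivative \<Psi> (at (z, h z)) w)" for w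
    proof (rule smooth_upto_compose[OF Z W])
      show "smooth_upto k W (\<lambda>y. frechet_derivative \<Psi> (at y) w)"
        using smooth_on_deriv[OF \<Psi>] smooth_on_iff_upto by blast
      show "smooth_upto k Z (\<lambda>z. (z, h z))"
        by (intro smooth_upto_Pair Z Suc.IH smooth_upto_bounded_linear bounded_linear_ident)
    qed (use graph in auto)
    show ?case
      by (rule smooth_upto_SucI[OF Z der], assumption)
         (intro smooth_upto_bilinear[OF _ bounded_bilinear_mult] smooth_upto_inverse Z D nz
            smooth_upto_linear_image[OF _ bounded_linear_minus[OF bounded_linear_ident]])
  qed
  then show ?thesis by (simp add: smooth_on_iff_upto)
qed

section \<open>Bump functions\<close>

text \<open>The span of this family is closed under differentiation.\<close>

definition flat :: "nat \<Rightarrow> real \<Rightarrow> real" where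
  "flat n x = (if x > 0 then inverse x ^ n * exp (- inverse x) else 0)"

text \<open>Only the point 0 is delicate. There the right difference quotient becomes y^(n+1) / exp
  y with y = 1/h, which tends to 0 as y grows; the left one is 0.\<close>

lemma flat_has_derivative:
  "(flat n has_real_derivative flat (n + 2) x - real n * flat (n + 1) x) (at x)"
proof -
  consider "x > 0" | "x < 0" | "x = 0" by linarith
  then show ?thesis
  proof cases
    case 1
    have "((\<lambda>x. inverse x ^ n * exp (- inverse x)) has_real_derivative
        flat (n + 2) x - real n * flat (n + 1) x) (at x)"
    proof (rule DERIV_cong)
      show "((\<lambda>x. inverse x ^ n * exp (- inverse x)) has_real_derivative
          (real n * (inverse x ^ (n - Suc 0) * - (inverse x ^ Suc (Suc 0)))) * exp (- inverse x) +
          inverse x ^ n * (exp (- inverse x) * (inverse x ^ Suc (Suc 0)))) (at x)"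
        using 1 by (auto intro!: derivative_eq_intros simp: algebra_simps)
      show "(real n * (inverse x ^ (n - Suc 0) * - (inverse x ^ Suc (Suc 0)))) * exp (- inverse x) +
          inverse x ^ n * (exp (- inverse x) * (inverse x ^ Suc (Suc 0))) =
          flat (n + 2) x - real n * flat (n + 1) x"
        using 1 by (cases n) (simp_all add: flat_def algebra_simps power_add)
    qed
    then show ?thesis
      by (rule has_field_derivative_transform_within_open[of _ _ _ "{0<..}"])
         (use 1 in \<open>auto simp: flat_def\<close>)
  next
    case 2
    have "((\<lambda>_. 0) has_real_derivative 0) (at x)" by simp
    then have "(flat n has_real_derivative 0) (at x)"
      by (rule has_field_derivative_transform_within_open[of _ _ _ "{..<0}"])
         (use 2 in \<open>auto simp: flat_def\<close>)
    then show ?thesis using 2 by (simp add: flat_def)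
  next
    case 3
    have "((\<lambda>h. flat n h / h) \<longlongrightarrow> 0) (at_right 0)"
    proof (rule Lim_transform_eventually)
      show "((\<lambda>h. inverse h ^ (n + 1) / exp (inverse h)) \<longlongrightarrow> (0::real)) (at_right 0)"
        by (rule filterlim_compose[OF tendsto_power_div_exp_0 filterlim_inverse_at_top_right])
      show "eventually (\<lambda>h. inverse h ^ (n + 1) / exp (inverse h) = flat n h / h) (at_right 0)"
        unfolding eventually_at_right_field
        by (rule exI[of _ 1]) (auto simp: flat_def exp_minus field_simps)
    qed
    moreover have "((\<lambda>h. flat n h / h) \<longlongrightarrow> 0) (at_left 0)"
      by (rule Lim_transform_eventually[OF tendsto_const])
         (auto simp: eventually_at_left_field flat_def intro!: exI[of _ "-1"])
    ultimately have "((\<lambda>h. flat n h / h) \<longlongrightarrow> 0) (at 0)" using filterlim_split_at by blast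
    then show ?thesis using 3 by (simp add: DERIV_def flat_def)
  qed
qed

lemma smooth_on_flat: "smooth_on UNIV (flat n)"
proof -
  have "smooth_upto k UNIV (flat n)" for k n
  proof (induction k arbitrary: n)
    case 0
    then show ?case
      using flat_has_derivative by (auto simp: smooth_upto_0 differentiable_def has_field_derivative_def)
  next
    case (Suc k)
    have "(flat n has_derivative (*) (flat (n + 2) x - real n * flat (n + 1) x)) (at x)" for x
      using flat_has_derivative has_field_derivative_def by blast
    moreover have "smooth_upto k UNIV (\<lambda>x. (flat (n + 2) x + (- real n) * flat (n + 1) x) * v)" for v
      by (intro smooth_upto_bilinear[OF _ bounded_bilinear_mult] smooth_upto_add Suc.IH
          smooth_upto_const open_UNIV)
    ultimately show ?case by (intro smooth_upto_SucI[OF open_UNIV]) auto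
  qed
  then show ?thesis by (simp add: smooth_on_iff_upto)
qed

text \<open>The classical smooth transition from 0 to 1. The denominator never vanishes because x
  and 1 - x cannot both be nonpositive.\<close>

definition smooth_step :: "real \<Rightarrow> real" where
  "smooth_step x = flat 0 x * inverse (flat 0 x + flat 0 (1 - x))"

lemma flat_nonneg: "flat n x \<ge> 0" by (simp add: flat_def)

lemma flat_add_pos: "flat 0 x + flat 0 (1 - x) > 0"
  by (auto simp: flat_def add_pos_pos)

lemma smooth_step_bounds: "0 \<le> smooth_step x" "smooth_step x \<le> 1"
  using flat_nonneg[of 0 x] flat_nonneg[of 0 "1 - x"] flat_add_pos[of x]
  by (auto simp: smooth_step_def field_simps)

lemma smooth_step_0: "x \<le> 0 \<Longrightarrow> smooth_step x = 0"
  by (simp add: smooth_step_def flat_def)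

lemma smooth_step_1: "x \<ge> 1 \<Longrightarrow> smooth_step x = 1"
  by (simp add: smooth_step_def flat_def)

lemma smooth_on_smooth_step: "smooth_on UNIV smooth_step"
proof -
  have "smooth_on UNIV (\<lambda>x::real. flat 0 (1 - x))"
    by (intro smooth_on_compose[OF _ _ _ smooth_on_flat] smooth_on_diff smooth_on_const
        smooth_on_ident) auto
  then show ?thesis
    unfolding smooth_step_def[abs_def]
    by (intro smooth_on_mult smooth_on_inverse smooth_on_add smooth_on_flat open_UNIV)
       (use flat_add_pos less_irrefl in metis)+
qed

lemma bump_function_exists:
  fixes c :: "'a::euclidean_space"
  assumes "r > 0"
  obtains \<beta> :: "'a \<Rightarrow> real" where "smooth_on UNIV \<beta>" "\<And>x. 0 \<le> \<beta> x" "\<And>x. \<beta> x \<le> 1"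
    "\<And>x. x \<in> ball c (r / 2) \<Longrightarrow> \<beta> x = 1" "\<And>x. x \<notin> cball c r \<Longrightarrow> \<beta> x = 0"
proof
  \<comment> \<open>The squared distance is used because the norm is not smooth at the centre. The
    factor makes the argument reach 1 once the squared distance is at most half of the square of
    \<open>r\<close>, which covers the ball of half the radius.\<close>
  define \<beta> where "\<beta> x = smooth_step ((r\<^sup>2 - (x - c) \<bullet> (x - c)) * (2 / r\<^sup>2))" for x
  show "smooth_on UNIV \<beta>"
    unfolding \<beta>_def[abs_def]
    by (intro smooth_on_compose[OF _ _ _ smooth_on_smooth_step] smooth_on_mult smooth_on_diff
        smooth_on_inner smooth_on_const smooth_on_ident) auto
  show "0 \<le> \<beta> x" "\<beta> x \<le> 1" for x by (simp_all add: \<beta>_def smooth_step_bounds)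
  show "\<beta> x = 1" if "x \<in> ball c (r / 2)" for x
  proof -
    have "(norm (x - c))\<^sup>2 \<le> (r / 2)\<^sup>2"
      using that by (intro power_mono) (auto simp: dist_norm norm_minus_commute)
    then have "(x - c) \<bullet> (x - c) * 4 \<le> r\<^sup>2" by (simp add: power2_norm_eq_inner power_divide)
    moreover have "0 \<le> (x - c) \<bullet> (x - c)" by simp
    ultimately have "(x - c) \<bullet> (x - c) * 2 \<le> r\<^sup>2" by linarith
    then show ?thesis
      unfolding \<beta>_def using assms by (intro smooth_step_1) (simp add: field_simps)
  qed
  show "\<beta> x = 0" if "x \<notin> cball c r" for x
  proof -
    have "r\<^sup>2 \<le> (norm (x - c))\<^sup>2"
      using that assms by (intro power_mono) (auto simp: dist_norm norm_minus_commute)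
    then show ?thesis
      unfolding \<beta>_def power2_norm_eq_inner by (intro smooth_step_0 mult_nonpos_nonneg) auto
  qed
qed

section \<open>Sliding points along a direction of growth\<close>

lemma ball_line_segment:
  fixes \<xi> v :: "'a::real_normed_vector"
  assumes "\<xi> + k1 *\<^sub>R v \<in> ball c R" "\<xi> + k2 *\<^sub>R v \<in> ball c R" "k1 \<le> k" "k \<le> k2"
  shows "\<xi> + k *\<^sub>R v \<in> ball c R"
proof (cases "k1 = k2")
  case False
  define u where "u = (k - k1) / (k2 - k1)"
  have u: "0 \<le> u" "u \<le> 1" using assms(3,4) False by (auto simp: u_def)
  have "u * (k2 - k1) = k - k1" using False by (simp add: u_def)
  then have k: "k = (1 - u) * k1 + u * k2" by (simp add: algebra_simps)
  have "(1 - u) *\<^sub>R (\<xi> + k1 *\<^sub>R v) + u *\<^sub>R (\<xi> + k2 *\<^sub>R v) \<in> ball c R"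
    by (rule convexD_alt[OF convex_ball assms(1,2) u])
  also have "(1 - u) *\<^sub>R (\<xi> + k1 *\<^sub>R v) + u *\<^sub>R (\<xi> + k2 *\<^sub>R v) = \<xi> + k *\<^sub>R v"
    by (simp add: k algebra_simps)
  finally show ?thesis .
qed (use assms in auto)

text \<open>The mean value theorem on a segment, which stays in the ball by convexity. This estimate
  is the source of existence, uniqueness and continuity of the slide.\<close>

lemma directional_growth:
  fixes F :: "real \<times> 'a::euclidean_space \<Rightarrow> real"
  assumes F: "\<And>\<xi>. \<xi> \<in> ball c R \<Longrightarrow> F differentiable at (s, \<xi>)"
    and a: "\<And>\<xi>. \<xi> \<in> ball c R \<Longrightarrow> a \<le> frechet_derivative F (at (s, \<xi>)) (0, v)"
    and k: "\<xi> + k1 *\<^sub>R v \<in> ball c R" "\<xi> + k2 *\<^sub>R v \<in> ball c R" "k1 \<le> k2"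
  shows "a * (k2 - k1) \<le> F (s, \<xi> + k2 *\<^sub>R v) - F (s, \<xi> + k1 *\<^sub>R v)"
proof (cases "k1 = k2")
  case False
  then have "k1 < k2" using k(3) by simp
  have "((\<lambda>k. F (s, \<xi> + k *\<^sub>R v)) has_real_derivative
      frechet_derivative F (at (s, \<xi> + k *\<^sub>R v)) (0, v)) (at k)"
    if "k1 \<le> k" "k \<le> k2" for k
  proof -
    let ?D = "frechet_derivative F (at (s, \<xi> + k *\<^sub>R v))"
    have D: "(F has_derivative ?D) (at (s, \<xi> + k *\<^sub>R v))"
      using F ball_line_segment[OF k(1,2) that] frechet_derivative_works by blast
    have "((\<lambda>k. F (s, \<xi> + k *\<^sub>R v)) has_derivative (\<lambda>h. ?D (0, h *\<^sub>R v))) (at k)"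
      by (rule has_derivative_compose[where f = "\<lambda>k. (s, \<xi> + k *\<^sub>R v)" and g = F])
         (use D in \<open>auto intro!: derivative_eq_intros\<close>)
    moreover have "?D (0, h *\<^sub>R v) = h * ?D (0, v)" for h
      using linear_scale[OF has_derivative_linear[OF D], of h "(0, v)"] by simp
    ultimately show ?thesis by (simp add: has_field_derivative_def mult_commute_abs)
  qed
  from MVT2[OF \<open>k1 < k2\<close> this] obtain z where z: "k1 < z" "z < k2"
    "F (s, \<xi> + k2 *\<^sub>R v) - F (s, \<xi> + k1 *\<^sub>R v) =
      (k2 - k1) * frechet_derivative F (at (s, \<xi> + z *\<^sub>R v)) (0, v)"
    by blast
  have "a \<le> frechet_derivative F (at (s, \<xi> + z *\<^sub>R v)) (0, v)"
    using a ball_line_segment[OF k(1,2)] z(1,2) by simp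
  then show ?thesis using z(3) \<open>k1 < k2\<close> by (simp add: mult.commute mult_left_mono)
qed simp

text \<open>On the line through \<xi> in direction \<open>v\<close> the function \<open>F\<close>
  grows at rate at least \<open>a\<close>, so a step of length (R - r)/2 either way outweighs |F -
  G| and the intermediate value theorem finds the displacement. Outside the smaller ball the
  displacement 0 works. Growth makes the solution unique and continuous, after which the implicit
  function theorem gives smoothness.\<close>

lemma box_implicit_function:
  fixes F G :: "real \<times> 'a::euclidean_space \<Rightarrow> real"
  assumes J: "open J" and rR: "r < R" and v: "norm v = 1" and a: "a > 0"
    and F: "smooth_on (J \<times> ball c R) F" and G: "smooth_on (J \<times> ball c R) G"
    and grow: "\<And>s \<xi>. s \<in> J \<Longrightarrow> \<xi> \<in> ball c R \<Longrightarrow> a \<le> frechet_derivative F (at (s, \<xi>)) (0, v)"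
    and off: "\<And>s \<xi>. s \<in> J \<Longrightarrow> \<xi> \<in> ball c R \<Longrightarrow> \<xi> \<notin> cball c r \<Longrightarrow> F (s, \<xi>) = G (s, \<xi>)"
    and close: "\<And>s \<xi>. s \<in> J \<Longrightarrow> \<xi> \<in> cball c r \<Longrightarrow> \<bar>F (s, \<xi>) - G (s, \<xi>)\<bar> \<le> a * ((R - r) / 2)"
  obtains h where "smooth_on (J \<times> ball c R) h"
    and "\<And>s \<xi>. s \<in> J \<Longrightarrow> \<xi> \<in> ball c R \<Longrightarrow>
      \<xi> + h (s, \<xi>) *\<^sub>R v \<in> ball c R \<and> F (s, \<xi> + h (s, \<xi>) *\<^sub>R v) = G (s, \<xi>)"
    and "\<And>s \<xi>. s \<in> J \<Longrightarrow> \<xi> \<in> ball c R \<Longrightarrow> F (s, \<xi>) = G (s, \<xi>) \<Longrightarrow> h (s, \<xi>) = 0"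
proof -
  let ?Z = "J \<times> ball c R"
  have Z: "open ?Z" using J by (simp add: open_Times)
  have growth: "a * (k2 - k1) \<le> F (s, \<xi> + k2 *\<^sub>R v) - F (s, \<xi> + k1 *\<^sub>R v)"
    if "s \<in> J" "\<xi> + k1 *\<^sub>R v \<in> ball c R" "\<xi> + k2 *\<^sub>R v \<in> ball c R" "k1 \<le> k2" for s \<xi> k1 k2
    by (rule directional_growth[of c R F s a v])
       (use that grow smooth_on_differentiable[OF F] in auto)
  define good where "good s \<xi> k \<longleftrightarrow> \<xi> + k *\<^sub>R v \<in> ball c R \<and> F (s, \<xi> + k *\<^sub>R v) = G (s, \<xi>)" for s \<xi> k
  have unique: "k1 = k2" if "s \<in> J" "good s \<xi> k1" "good s \<xi> k2" for s \<xi> k1 k2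
  proof -
    have "k1 \<le> k2 \<Longrightarrow> a * (k2 - k1) \<le> 0" "k2 \<le> k1 \<Longrightarrow> a * (k1 - k2) \<le> 0"
      using growth[of s \<xi> k1 k2] growth[of s \<xi> k2 k1] that by (auto simp: good_def)
    then show ?thesis using a by (smt (verit) mult_pos_pos)
  qed
  have ex: "\<exists>k. good s \<xi> k" if s: "s \<in> J" and \<xi>: "\<xi> \<in> ball c R" for s \<xi>
  proof (cases "\<xi> \<in> cball c r")
    case False
    then show ?thesis using off that by (intro exI[of _ 0]) (simp add: good_def)
  next
    case True
    \<comment> \<open>Half the gap between the radii: a point of the closed ball of radius
      \<open>r\<close> moved by at most this much stays strictly inside radius
      \<open>R\<close>.\<close>
    define \<delta> where "\<delta> = (R - r) / 2"
    have \<delta>: "\<delta> > 0" using rR by (simp add: \<delta>_def)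
    have in_ball: "\<xi> + k *\<^sub>R v \<in> ball c R" if "\<bar>k\<bar> \<le> \<delta>" for k
    proof -
      have "dist c (\<xi> + k *\<^sub>R v) \<le> dist c \<xi> + \<bar>k\<bar>"
        using dist_triangle[of c "\<xi> + k *\<^sub>R v" \<xi>] v by (simp add: dist_norm)
      then show ?thesis using True that rR by (auto simp: \<delta>_def field_simps)
    qed
    have "continuous_on {-\<delta>..\<delta>} (\<lambda>k. F (s, \<xi> + k *\<^sub>R v))"
    proof (rule continuous_on_compose2[OF smooth_on_continuous_on[OF F]])
      show "continuous_on {-\<delta>..\<delta>} (\<lambda>k. (s, \<xi> + k *\<^sub>R v))" by (intro continuous_intros)
    qed (use in_ball s in auto)
    moreover have "F (s, \<xi> + (-\<delta>) *\<^sub>R v) \<le> G (s, \<xi>)" "G (s, \<xi>) \<le> F (s, \<xi> + \<delta> *\<^sub>R v)"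
      using growth[of s \<xi> "-\<delta>" 0] growth[of s \<xi> 0 \<delta>] s close[OF s True] \<delta> in_ball[of \<delta>] in_ball[of "-\<delta>"] \<xi>
      by (auto simp: \<delta>_def[symmetric] abs_le_iff)
    ultimately obtain k where "-\<delta> \<le> k" "k \<le> \<delta>" "F (s, \<xi> + k *\<^sub>R v) = G (s, \<xi>)"
      using IVT'[of "\<lambda>k. F (s, \<xi> + k *\<^sub>R v)" "-\<delta>" "G (s, \<xi>)" \<delta>] \<delta> by auto
    then show ?thesis using in_ball[of k] by (intro exI[of _ k]) (auto simp: good_def)
  qed
  define h where "h z = (THE k. good (fst z) (snd z) k)" for z
  have good: "good s \<xi> (h (s, \<xi>))" if "s \<in> J" "\<xi> \<in> ball c R" for s \<xi>
    unfolding h_def fst_conv snd_conv using theI'[of "good s \<xi>"] ex[OF that] unique that by blast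
  have cont: "continuous_on ?Z h"
  proof (intro continuous_at_imp_continuous_on ballI)
    fix z assume z: "z \<in> ?Z"
    obtain s \<xi> where sx: "z = (s, \<xi>)" "s \<in> J" "\<xi> \<in> ball c R" using z by (cases z) auto
    let ?k = "h z"
    have gz: "good s \<xi> ?k" using good sx by simp
    obtain e where e: "e > 0" "ball (\<xi> + ?k *\<^sub>R v) e \<subseteq> ball c R"
      using gz openE[OF open_ball] by (metis good_def)
    have in_ball: "\<xi> + k *\<^sub>R v \<in> ball c R" if "\<bar>k - ?k\<bar> < e" for k
    proof -
      have "dist (\<xi> + ?k *\<^sub>R v) (\<xi> + k *\<^sub>R v) < e"
        using that v by (simp add: dist_norm scaleR_diff_left[symmetric] abs_minus_commute)
      then show ?thesis using e(2) mem_ball by blast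
    qed
    have zev: "eventually (\<lambda>y. y \<in> ?Z) (at z)"
      using Z z eventually_at_topological by blast
    \<comment> \<open>\<open>P k y\<close> compares \<open>F\<close> after a trial displacement
      \<open>k\<close> with the target \<open>G y\<close>. By growth its sign tells on which side of
      \<open>k\<close> the true value \<open>h y\<close> lies, and a strict sign at \<open>z\<close>
      persists nearby.\<close>
    define P where "P k y = F (fst y, snd y + k *\<^sub>R v) - G y" for k y
    have near: "eventually (\<lambda>y. snd y + k *\<^sub>R v \<in> ball c R) (at z)" "(P k \<longlongrightarrow> P k z) (at z)"
      if "\<bar>k - ?k\<bar> < e" for k
    proof -
      have t: "((\<lambda>y. (fst y, snd y + k *\<^sub>R v)) \<longlongrightarrow> (fst z, snd z + k *\<^sub>R v)) (at z)"
        by (intro tendsto_intros)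
      show "eventually (\<lambda>y. snd y + k *\<^sub>R v \<in> ball c R) (at z)"
        using topological_tendstoD[OF tendsto_snd[OF t], of "ball c R"] in_ball[OF that] sx by auto
      have "isCont F (fst z, snd z + k *\<^sub>R v)" "isCont G z"
        using smooth_on_isCont[OF F] smooth_on_isCont[OF G] in_ball[OF that] sx z by auto
      then show "(P k \<longlongrightarrow> P k z) (at z)"
        unfolding P_def by (intro tendsto_diff isCont_tendsto_compose[OF _ t]) (auto simp: isCont_def)
    qed
    have "(h \<longlongrightarrow> h z) (at z)"
    proof (rule order_tendstoI)
      fix b assume "b < h z"
      \<comment> \<open>A trial value strictly between \<open>b\<close> and \<open>h z\<close>, kept
        within \<open>e\<close> of \<open>h z\<close> so that the displaced point remains in the
        ball.\<close>
      define k where "k = max ((b + h z) / 2) (h z - e / 2)"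
      have k: "b < k" "k < h z" "\<bar>k - ?k\<bar> < e" using \<open>b < h z\<close> e(1) by (auto simp: k_def max_def field_simps)
      have "a * (?k - k) \<le> - P k z"
        using growth[of s \<xi> k ?k] gz in_ball[OF k(3)] k(2) sx by (simp add: good_def P_def)
      then have "P k z < 0" using a k(2) by (smt (verit) mult_pos_pos)
      then have "eventually (\<lambda>y. P k y < 0) (at z)" using near(2)[OF k(3)] order_tendstoD by blast
      with near(1)[OF k(3)] zev show "eventually (\<lambda>y. b < h y) (at z)"
      proof eventually_elim
        fix y assume y: "snd y + k *\<^sub>R v \<in> ball c R" "y \<in> ?Z" "P k y < 0"
        have g: "good (fst y) (snd y) (h y)" using good y(2) by (cases y) auto
        show "b < h y"
        proof (rule ccontr)
          assume "\<not> b < h y"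
          then have "a * (k - h y) \<le> P k y" "k > h y"
            using growth[of "fst y" "snd y" "h y" k] g y k by (auto simp: good_def P_def)
          then show False using a y(3) by (smt (verit) mult_pos_pos)
        qed
      qed
    next
      fix b assume "h z < b"
      define k where "k = min ((b + h z) / 2) (h z + e / 2)"
      have k: "k < b" "h z < k" "\<bar>k - ?k\<bar> < e" using \<open>h z < b\<close> e(1) by (auto simp: k_def min_def field_simps)
      have "a * (k - ?k) \<le> P k z"
        using growth[of s \<xi> ?k k] gz in_ball[OF k(3)] k(2) sx by (simp add: good_def P_def)
      then have "P k z > 0" using a k(2) by (smt (verit) mult_pos_pos)
      then have "eventually (\<lambda>y. P k y > 0) (at z)" using near(2)[OF k(3)] order_tendstoD by blast
      with near(1)[OF k(3)] zev show "eventually (\<lambda>y. h y < b) (at z)"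
      proof eventually_elim
        fix y assume y: "snd y + k *\<^sub>R v \<in> ball c R" "y \<in> ?Z" "P k y > 0"
        have g: "good (fst y) (snd y) (h y)" using good y(2) by (cases y) auto
        show "h y < b"
        proof (rule ccontr)
          assume "\<not> h y < b"
          then have "a * (h y - k) \<le> - P k y" "k < h y"
            using growth[of "fst y" "snd y" k "h y"] g y k by (auto simp: good_def P_def)
          then show False using a y(3) by (smt (verit) mult_pos_pos)
        qed
      qed
    qed
    then show "isCont h z" by (simp add: isCont_def)
  qed
  define q :: "(real \<times> 'a) \<times> real \<Rightarrow> real \<times> 'a" where "q y = (fst (fst y), snd (fst y) + snd y *\<^sub>R v)" for y
  define W where "W = {y. fst y \<in> ?Z} \<inter> {y. q y \<in> ?Z}"
  \<comment> \<open>A zero of \<open>\<Psi>\<close> at (z, k) says that \<open>k\<close> is the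
    displacement at \<open>z\<close>; \<open>W\<close> requires both the point and its displaced
    position to lie in the box.\<close>
  define \<Psi> where "\<Psi> y = F (q y) - G (fst y)" for y
  have q: "smooth_on UNIV q"
    unfolding q_def[abs_def]
    by (intro smooth_on_Pair smooth_on_add smooth_on_linear_image[OF _ bounded_linear_fst]
        smooth_on_linear_image[OF _ bounded_linear_snd] smooth_on_ident smooth_on_const
        smooth_on_scaleR open_UNIV)
  have W: "open W"
  proof -
    have "open {y. q y \<in> ?Z}" "open {y :: (real \<times> 'a) \<times> real. fst y \<in> ?Z}"
      using open_vimage[OF Z smooth_on_continuous_on[OF q]] open_vimage[OF Z continuous_on_fst[OF continuous_on_id]]
      by (auto simp: vimage_def)
    then show ?thesis by (simp add: W_def open_Int)
  qed
  have "smooth_on ?Z h"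
  proof (rule implicit_function_smooth[of ?Z W \<Psi>, OF Z W _ cont])
    show "smooth_on W \<Psi>"
      unfolding \<Psi>_def[abs_def]
      by (intro smooth_on_diff W smooth_on_compose[OF W Z _ F] smooth_on_compose[OF W Z _ G]
          smooth_on_subset[OF q] smooth_on_fst) (auto simp: W_def)
    fix z assume z: "z \<in> ?Z"
    then obtain s \<xi> where sx: "z = (s, \<xi>)" "s \<in> J" "\<xi> \<in> ball c R" by (cases z) auto
    have g: "good s \<xi> (h z)" using good sx by simp
    show W': "(z, h z) \<in> W" using sx g by (auto simp: W_def q_def good_def)
    show "\<Psi> (z, h z) = 0" using sx g by (simp add: \<Psi>_def q_def good_def)
    let ?D = "frechet_derivative F (at (q (z, h z)))"
    have "(q has_derivative (\<lambda>w. (fst (fst w), snd (fst w) + snd w *\<^sub>R v))) (at (z, h z))"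
      unfolding q_def[abs_def] by (auto intro!: derivative_eq_intros)
    moreover have "(F has_derivative ?D) (at (q (z, h z)))"
      using W' by (intro smooth_on_has_derivative[OF F]) (simp add: W_def)
    ultimately have 1: "((\<lambda>y. F (q y)) has_derivative
        (\<lambda>w. ?D (fst (fst w), snd (fst w) + snd w *\<^sub>R v))) (at (z, h z))"
      by (rule has_derivative_compose)
    have "(fst has_derivative fst) (at (z, h z))"
      by (rule bounded_linear_imp_has_derivative[OF bounded_linear_fst])
    moreover have "(G has_derivative frechet_derivative G (at z)) (at (fst (z, h z)))"
      using z by (auto intro: smooth_on_has_derivative[OF G])
    ultimately have 2: "((\<lambda>y. G (fst y)) has_derivative
        (\<lambda>w. frechet_derivative G (at z) (fst w))) (at (z, h z))"
      by (rule has_derivative_compose)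
    \<comment> \<open>In the last slot only the displacement varies, so the derivative there is that
      of \<open>F\<close> along \<open>v\<close>, which is at least \<open>a\<close>.\<close>
    have "frechet_derivative \<Psi> (at (z, h z)) =
        (\<lambda>w. ?D (fst (fst w), snd (fst w) + snd w *\<^sub>R v) - frechet_derivative G (at z) (fst w))"
      unfolding \<Psi>_def[abs_def]
      by (rule frechet_derivative_at[OF has_derivative_diff[OF 1 2], symmetric])
    moreover have "frechet_derivative G (at z) 0 = 0"
      using z linear_0 linear_frechet_derivative smooth_on_differentiable[OF G] by blast
    ultimately have "frechet_derivative \<Psi> (at (z, h z)) (0, 1) = ?D (0, v)"
      by (simp add: zero_prod_def)
    moreover have "a \<le> ?D (0, v)"
      using grow[of s "\<xi> + h z *\<^sub>R v"] g sx by (simp add: q_def good_def)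
    ultimately show "frechet_derivative \<Psi> (at (z, h z)) (0, 1) \<noteq> 0" using a by simp
  qed
  moreover have "h (s, \<xi>) = 0" if "s \<in> J" "\<xi> \<in> ball c R" "F (s, \<xi>) = G (s, \<xi>)" for s \<xi>
    using unique[OF that(1) good[OF that(1,2)], of 0] that by (simp add: good_def)
  ultimately show thesis using that[of h] good by (simp add: good_def)
qed

text \<open>\<open>\<eta>\<close> moves a point along \<open>v\<close> until \<open>F\<close> takes
  its old \<open>G\<close>-value; \<open>\<theta>\<close> does the same with \<open>F\<close> and
  \<open>G\<close> exchanged. Then \<open>\<theta>\<close> after \<open>\<eta>\<close> moves a point
  along \<open>v\<close> without changing its \<open>G\<close>-value, and growth of \<open>G\<close>
  forces the total displacement to be 0. The other order works with \<open>F\<close>. Hence growth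
  is demanded of both functions.\<close>

lemma box_isotopy:
  fixes F G :: "real \<times> 'a::euclidean_space \<Rightarrow> real"
  assumes J: "open J" and rR: "r < R" and v: "norm v = 1" and a: "a > 0"
    and F: "smooth_on (J \<times> ball c R) F" and G: "smooth_on (J \<times> ball c R) G"
    and growF: "\<And>s \<xi>. s \<in> J \<Longrightarrow> \<xi> \<in> ball c R \<Longrightarrow> a \<le> frechet_derivative F (at (s, \<xi>)) (0, v)"
    and growG: "\<And>s \<xi>. s \<in> J \<Longrightarrow> \<xi> \<in> ball c R \<Longrightarrow> a \<le> frechet_derivative G (at (s, \<xi>)) (0, v)"
    and off: "\<And>s \<xi>. s \<in> J \<Longrightarrow> \<xi> \<in> ball c R \<Longrightarrow> \<xi> \<notin> cball c r \<Longrightarrow> F (s, \<xi>) = G (s, \<xi>)"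
    and close: "\<And>s \<xi>. s \<in> J \<Longrightarrow> \<xi> \<in> cball c r \<Longrightarrow> \<bar>F (s, \<xi>) - G (s, \<xi>)\<bar> \<le> a * ((R - r) / 2)"
  obtains \<eta> \<theta> where
    "smooth_on (J \<times> ball c R) \<eta>" "smooth_on (J \<times> ball c R) \<theta>"
    "\<And>s \<xi>. s \<in> J \<Longrightarrow> \<xi> \<in> ball c R \<Longrightarrow> \<eta> (s, \<xi>) \<in> ball c R \<and> \<theta> (s, \<xi>) \<in> ball c R"
    "\<And>s \<xi>. s \<in> J \<Longrightarrow> \<xi> \<in> ball c R \<Longrightarrow> \<theta> (s, \<eta> (s, \<xi>)) = \<xi> \<and> \<eta> (s, \<theta> (s, \<xi>)) = \<xi>"
    "\<And>s \<xi>. s \<in> J \<Longrightarrow> \<xi> \<in> ball c R \<Longrightarrow> F (s, \<eta> (s, \<xi>)) = G (s, \<xi>)"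
    "\<And>s \<xi>. s \<in> J \<Longrightarrow> \<xi> \<in> ball c R \<Longrightarrow> F (s, \<xi>) = G (s, \<xi>) \<Longrightarrow> \<eta> (s, \<xi>) = \<xi> \<and> \<theta> (s, \<xi>) = \<xi>"
proof -
  let ?Z = "J \<times> ball c R"
  have Z: "open ?Z" using J by (simp add: open_Times)
  obtain h where h: "smooth_on ?Z h"
    "\<And>s \<xi>. s \<in> J \<Longrightarrow> \<xi> \<in> ball c R \<Longrightarrow>
      \<xi> + h (s, \<xi>) *\<^sub>R v \<in> ball c R \<and> F (s, \<xi> + h (s, \<xi>) *\<^sub>R v) = G (s, \<xi>)"
    "\<And>s \<xi>. s \<in> J \<Longrightarrow> \<xi> \<in> ball c R \<Longrightarrow> F (s, \<xi>) = G (s, \<xi>) \<Longrightarrow> h (s, \<xi>) = 0"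
    using box_implicit_function[OF J rR v a F G growF off close] by blast
  obtain k where k: "smooth_on ?Z k"
    "\<And>s \<xi>. s \<in> J \<Longrightarrow> \<xi> \<in> ball c R \<Longrightarrow>
      \<xi> + k (s, \<xi>) *\<^sub>R v \<in> ball c R \<and> G (s, \<xi> + k (s, \<xi>) *\<^sub>R v) = F (s, \<xi>)"
    "\<And>s \<xi>. s \<in> J \<Longrightarrow> \<xi> \<in> ball c R \<Longrightarrow> G (s, \<xi>) = F (s, \<xi>) \<Longrightarrow> k (s, \<xi>) = 0"
    using box_implicit_function[OF J rR v a G F growG off[symmetric]
        close[unfolded abs_minus_commute[of "F _"]]]
    by blast
  have inj: "l = 0"
    if "s \<in> J" "\<xi> \<in> ball c R" "\<xi> + l *\<^sub>R v \<in> ball c R" "E (s, \<xi> + l *\<^sub>R v) = E (s, \<xi>)"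
      "E \<in> {F, G}" for s \<xi> l E
  proof -
    have growth: "a * (k2 - k1) \<le> E (s, \<xi> + k2 *\<^sub>R v) - E (s, \<xi> + k1 *\<^sub>R v)"
      if "\<xi> + k1 *\<^sub>R v \<in> ball c R" "\<xi> + k2 *\<^sub>R v \<in> ball c R" "k1 \<le> k2" for k1 k2
      by (rule directional_growth[of c R E s a v])
         (use that \<open>s \<in> J\<close> \<open>E \<in> {F, G}\<close> growF growG smooth_on_differentiable[OF F]
            smooth_on_differentiable[OF G] in auto)
    have "0 \<le> l \<Longrightarrow> a * l \<le> 0" "l \<le> 0 \<Longrightarrow> a * - l \<le> 0"
      using growth[of 0 l] growth[of l 0] that(2-4) by auto
    then show ?thesis using a by (smt (verit) mult_pos_pos)
  qed
  define \<eta> \<theta> where "\<eta> z = snd z + h z *\<^sub>R v" and "\<theta> z = snd z + k z *\<^sub>R v" for z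
  show thesis
  proof
    show "smooth_on ?Z \<eta>" "smooth_on ?Z \<theta>"
      unfolding \<eta>_def[abs_def] \<theta>_def[abs_def]
      by (intro smooth_on_add smooth_on_snd smooth_on_scaleR smooth_on_const Z h(1) k(1))+
    fix s \<xi> assume s: "s \<in> J" "\<xi> \<in> ball c R"
    show mem: "\<eta> (s, \<xi>) \<in> ball c R \<and> \<theta> (s, \<xi>) \<in> ball c R"
      using h(2)[OF s] k(2)[OF s] by (simp add: \<eta>_def \<theta>_def)
    show F\<eta>: "F (s, \<eta> (s, \<xi>)) = G (s, \<xi>)" using h(2)[OF s] by (simp add: \<eta>_def)
    have G\<theta>: "G (s, \<theta> (s, \<xi>)) = F (s, \<xi>)" using k(2)[OF s] by (simp add: \<theta>_def)
    show "\<eta> (s, \<xi>) = \<xi> \<and> \<theta> (s, \<xi>) = \<xi>" if "F (s, \<xi>) = G (s, \<xi>)"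
      using h(3)[OF s that] k(3)[OF s that[symmetric]] by (simp add: \<eta>_def \<theta>_def)
    have 1: "\<theta> (s, \<eta> (s, \<xi>)) = \<xi> + (h (s, \<xi>) + k (s, \<eta> (s, \<xi>))) *\<^sub>R v"
      and 2: "\<eta> (s, \<theta> (s, \<xi>)) = \<xi> + (k (s, \<xi>) + h (s, \<theta> (s, \<xi>))) *\<^sub>R v"
      by (simp_all add: \<eta>_def \<theta>_def scaleR_add_left)
    have "\<theta> (s, \<eta> (s, \<xi>)) \<in> ball c R" "G (s, \<theta> (s, \<eta> (s, \<xi>))) = G (s, \<xi>)"
      using k(2)[OF s(1) conjunct1[OF mem]] F\<eta> by (simp_all add: \<theta>_def)
    then have "h (s, \<xi>) + k (s, \<eta> (s, \<xi>)) = 0" unfolding 1 by (rule inj[OF s]) simp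
    moreover have "\<eta> (s, \<theta> (s, \<xi>)) \<in> ball c R" "F (s, \<eta> (s, \<theta> (s, \<xi>))) = F (s, \<xi>)"
      using h(2)[OF s(1) conjunct2[OF mem]] G\<theta> by (simp_all add: \<eta>_def)
    then have "k (s, \<xi>) + h (s, \<theta> (s, \<xi>)) = 0" unfolding 2 by (rule inj[OF s]) simp
    ultimately show "\<theta> (s, \<eta> (s, \<xi>)) = \<xi> \<and> \<eta> (s, \<theta> (s, \<xi>)) = \<xi>"
      unfolding 1 2 by simp
  qed
qed

text \<open>The box isotopy for F = u - s w and G = u. As |s| \<le> 2, the rate 3 a loses at most 2
  a to the term s w and leaves a; the same factor turns the bound a R / 8 into a R / 4, which is a
  ((R - R/2)/2). Points with s w = 0 are fixed, so the map is the identity at s = 0 and off the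
  smaller ball.\<close>

lemma interpolation_isotopy:
  fixes u w :: "'a::euclidean_space \<Rightarrow> real"
  assumes R: "R > 0" and v: "norm v = 1" and a: "a > 0"
    and u: "smooth_on (ball c R) u" and w: "smooth_on (ball c R) w"
    and Du: "\<And>\<xi>. \<xi> \<in> ball c R \<Longrightarrow> 3 * a \<le> frechet_derivative u (at \<xi>) v"
    and Dw: "\<And>\<xi>. \<xi> \<in> ball c R \<Longrightarrow> \<bar>frechet_derivative w (at \<xi>) v\<bar> \<le> a"
    and off: "\<And>\<xi>. \<xi> \<in> ball c R \<Longrightarrow> \<xi> \<notin> cball c (R / 2) \<Longrightarrow> w \<xi> = 0"
    and close: "\<And>\<xi>. \<xi> \<in> ball c R \<Longrightarrow> \<bar>w \<xi>\<bar> \<le> a * R / 8"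
  obtains \<eta> \<theta> where
    "smooth_on ({-1<..<2::real} \<times> ball c R) \<eta>" "smooth_on ({-1<..<2::real} \<times> ball c R) \<theta>"
    "\<And>s \<xi>. s \<in> {-1<..<2} \<Longrightarrow> \<xi> \<in> ball c R \<Longrightarrow> \<eta> (s, \<xi>) \<in> ball c R \<and> \<theta> (s, \<xi>) \<in> ball c R"
    "\<And>s \<xi>. s \<in> {-1<..<2} \<Longrightarrow> \<xi> \<in> ball c R \<Longrightarrow> \<theta> (s, \<eta> (s, \<xi>)) = \<xi> \<and> \<eta> (s, \<theta> (s, \<xi>)) = \<xi>"
    "\<And>s \<xi>. s \<in> {-1<..<2} \<Longrightarrow> \<xi> \<in> ball c R \<Longrightarrow> u (\<eta> (s, \<xi>)) - s * w (\<eta> (s, \<xi>)) = u \<xi>"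
    "\<And>s \<xi>. s \<in> {-1<..<2} \<Longrightarrow> \<xi> \<in> ball c R \<Longrightarrow> s * w \<xi> = 0 \<Longrightarrow> \<eta> (s, \<xi>) = \<xi> \<and> \<theta> (s, \<xi>) = \<xi>"
proof -
  define J where "J = {-1<..<2::real}"
  let ?Z = "J \<times> ball c R"
  have J: "open J" by (simp add: J_def)
  have Z: "open ?Z" using J by (simp add: open_Times)
  define F G where "F z = u (snd z) - fst z * w (snd z)" and "G z = u (snd z)" for z :: "real \<times> 'a"
  have smooth_snd: "smooth_on ?Z (\<lambda>z. f (snd z))" if "smooth_on (ball c R) f" for f :: "'a \<Rightarrow> real"
    by (rule smooth_on_compose[OF Z open_ball _ that smooth_on_snd[OF Z]]) auto
  have der: "frechet_derivative F (at (s, \<xi>)) (0, v) =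
      frechet_derivative u (at \<xi>) v - s * frechet_derivative w (at \<xi>) v"
    "frechet_derivative G (at (s, \<xi>)) (0, v) = frechet_derivative u (at \<xi>) v"
    if "\<xi> \<in> ball c R" for s \<xi>
  proof -
    have snd: "((\<lambda>z. f (snd z)) has_derivative (\<lambda>z. frechet_derivative f (at \<xi>) (snd z))) (at (s, \<xi>))"
      if "smooth_on (ball c R) f" for f :: "'a \<Rightarrow> real"
    proof -
      have "(snd has_derivative snd) (at (s, \<xi>))"
        by (rule bounded_linear_imp_has_derivative[OF bounded_linear_snd])
      moreover have "(f has_derivative frechet_derivative f (at \<xi>)) (at (snd (s, \<xi>)))"
        using smooth_on_has_derivative[OF that \<open>\<xi> \<in> ball c R\<close>] by simp
      ultimately show ?thesis by (rule has_derivative_compose)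
    qed
    have fst: "(fst has_derivative fst) (at (s, \<xi>))"
      by (rule bounded_linear_imp_has_derivative[OF bounded_linear_fst])
    have "frechet_derivative F (at (s, \<xi>)) =
        (\<lambda>z. frechet_derivative u (at \<xi>) (snd z) -
          (fst (s, \<xi>) * frechet_derivative w (at \<xi>) (snd z) + fst z * w (snd (s, \<xi>))))"
      unfolding F_def[abs_def]
      by (rule frechet_derivative_at[OF has_derivative_diff[OF snd[OF u] has_derivative_mult[OF fst snd[OF w]]],
            symmetric])
    then show "frechet_derivative F (at (s, \<xi>)) (0, v) =
        frechet_derivative u (at \<xi>) v - s * frechet_derivative w (at \<xi>) v" by simp
    show "frechet_derivative G (at (s, \<xi>)) (0, v) = frechet_derivative u (at \<xi>) v"
      unfolding G_def[abs_def] using frechet_derivative_at[OF snd[OF u]] by (metis snd_conv)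
  qed
  have abs_s: "\<bar>s\<bar> \<le> 2" if "s \<in> J" for s using that by (auto simp: J_def)
  have scaled: "\<bar>s * b\<bar> \<le> 2 * B" if "s \<in> J" "\<bar>b\<bar> \<le> B" for s b B
    unfolding abs_mult using abs_s[OF that(1)] that(2) by (intro mult_mono) auto
  obtain \<eta> \<theta> where \<eta>\<theta>: "smooth_on ?Z \<eta>" "smooth_on ?Z \<theta>"
    "\<And>s \<xi>. s \<in> J \<Longrightarrow> \<xi> \<in> ball c R \<Longrightarrow> \<eta> (s, \<xi>) \<in> ball c R \<and> \<theta> (s, \<xi>) \<in> ball c R"
    "\<And>s \<xi>. s \<in> J \<Longrightarrow> \<xi> \<in> ball c R \<Longrightarrow> \<theta> (s, \<eta> (s, \<xi>)) = \<xi> \<and> \<eta> (s, \<theta> (s, \<xi>)) = \<xi>"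
    "\<And>s \<xi>. s \<in> J \<Longrightarrow> \<xi> \<in> ball c R \<Longrightarrow> F (s, \<eta> (s, \<xi>)) = G (s, \<xi>)"
    "\<And>s \<xi>. s \<in> J \<Longrightarrow> \<xi> \<in> ball c R \<Longrightarrow> F (s, \<xi>) = G (s, \<xi>) \<Longrightarrow> \<eta> (s, \<xi>) = \<xi> \<and> \<theta> (s, \<xi>) = \<xi>"
  proof (rule box_isotopy[OF J _ v a, of "R / 2" R c F G])
    show "R / 2 < R" using R by simp
    show "smooth_on ?Z G" unfolding G_def[abs_def] by (rule smooth_snd[OF u])
    show "smooth_on ?Z F"
      unfolding F_def[abs_def]
      by (intro smooth_on_diff[OF Z] smooth_on_mult[OF Z] smooth_on_fst[OF Z] smooth_snd u w)
    fix s \<xi> assume s: "s \<in> J"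
    show "a \<le> frechet_derivative F (at (s, \<xi>)) (0, v)" if "\<xi> \<in> ball c R"
      using der(1)[OF that, of s] Du[OF that] scaled[OF s Dw[OF that]] by linarith
    show "a \<le> frechet_derivative G (at (s, \<xi>)) (0, v)" if "\<xi> \<in> ball c R"
      using der(2)[OF that, of s] Du[OF that] a by linarith
    show "F (s, \<xi>) = G (s, \<xi>)" if "\<xi> \<in> ball c R" "\<xi> \<notin> cball c (R / 2)"
      using off[OF that] by (simp add: F_def G_def)
    show "\<bar>F (s, \<xi>) - G (s, \<xi>)\<bar> \<le> a * ((R - R / 2) / 2)" if "\<xi> \<in> cball c (R / 2)"
    proof -
      have "\<xi> \<in> ball c R" using that R by auto
      from scaled[OF s close[OF this]] show ?thesis by (simp add: F_def G_def mult.commute[of R a])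
    qed
  qed blast
  show thesis
    by (rule that[of \<eta> \<theta>, folded J_def, OF \<eta>\<theta>(1-4)])
       (use \<eta>\<theta>(5,6) in \<open>auto simp: F_def G_def\<close>)
qed

section \<open>Smooth maps on manifolds\<close>

lemma local_rep_apply [simp]: "local_rep (U, x) f \<xi> = f (inv_into U x \<xi>)"
  by (simp add: local_rep_def)

section \<open>Charts and smooth functions\<close>

locale smooth_manifold =
  fixes A :: "('m::t2_space, 'n::finite) chart set"
  assumes atlas: "smooth_atlas A"
begin

lemma chart_cover: obtains U x where "(U, x) \<in> A" "p \<in> U"
proof -
  have "p \<in> (\<Union>(U, x)\<in>A. U)" using atlas unfolding smooth_atlas_def by simp
  then show thesis using that by blast
qed

context
  fixes U and x :: "'m \<Rightarrow> real^'n"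
  assumes chart: "(U, x) \<in> A"
begin

lemma chart_homeomorphism: "homeomorphism U (x ` U) x (inv_into U x)"
  using atlas chart unfolding smooth_atlas_def by blast

lemma open_chart_domain: "open U" and open_chart_range: "open (x ` U)"
  using atlas chart unfolding smooth_atlas_def by blast+

lemma chart_inverse: "p \<in> U \<Longrightarrow> inv_into U x (x p) = p"
  using chart_homeomorphism homeomorphism_apply1 by blast

lemma chart_inverse_mem: "\<xi> \<in> x ` U \<Longrightarrow> inv_into U x \<xi> \<in> U"
  by (rule inv_into_into)

lemma chart_apply_inverse: "\<xi> \<in> x ` U \<Longrightarrow> x (inv_into U x \<xi>) = \<xi>"
  by (rule f_inv_into_f)

lemma continuous_on_chart: "continuous_on U x"
  and continuous_on_chart_inverse: "continuous_on (x ` U) (inv_into U x)"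
  using chart_homeomorphism by (auto simp: homeomorphism_def)

lemma open_chart_image: "open W \<Longrightarrow> W \<subseteq> U \<Longrightarrow> open (x ` W)"
  by (metis chart_homeomorphism homeomorphism_imp_open_map open_chart_range open_subset
      openin_open_trans openin_open_eq open_chart_domain)

lemma chart_vimage_eq: "T \<subseteq> x ` U \<Longrightarrow> inv_into U x ` T = {p \<in> U. x p \<in> T}"
  using chart_inverse chart_apply_inverse chart_inverse_mem by (fastforce simp: image_iff)

lemma open_chart_vimage: "open T \<Longrightarrow> open {p \<in> U. x p \<in> T}"
  using continuous_open_preimage[OF continuous_on_chart open_chart_domain]
  by (simp add: vimage_def Int_def)

lemma chart_image_Int_iff: "\<xi> \<in> x ` (U \<inter> W) \<longleftrightarrow> \<xi> \<in> x ` U \<and> inv_into U x \<xi> \<in> W"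
  using chart_inverse chart_apply_inverse chart_inverse_mem by (fastforce simp: image_iff)

end

lemma smooth_on_transition:
  "(U, x) \<in> A \<Longrightarrow> (V, y) \<in> A \<Longrightarrow> smooth_on (x ` (U \<inter> V)) (\<lambda>\<xi>. y (inv_into U x \<xi>))"
  using atlas unfolding smooth_atlas_def local_rep_def comp_def by fastforce

lemma smooth_fun_chart: "smooth_fun A f \<Longrightarrow> (U, x) \<in> A \<Longrightarrow> smooth_on (x ` U) (\<lambda>\<xi>. f (inv_into U x \<xi>))"
  unfolding smooth_fun_def local_rep_def comp_def by fastforce

lemma smooth_funI:
  assumes "\<And>U x. (U, x) \<in> A \<Longrightarrow> smooth_on (x ` U) (\<lambda>\<xi>. f (inv_into U x \<xi>))"
  shows "smooth_fun A f"
  using assms unfolding smooth_fun_def local_rep_def comp_def by auto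

lemma smooth_fun_const: "smooth_fun A (\<lambda>_. c)"
  by (intro smooth_funI smooth_on_const open_chart_range)

lemma smooth_fun_diff: "smooth_fun A f \<Longrightarrow> smooth_fun A g \<Longrightarrow> smooth_fun A (\<lambda>p. f p - g p)"
  by (rule smooth_funI, rule smooth_on_diff) (auto intro: open_chart_range smooth_fun_chart)

lemma smooth_fun_mult: "smooth_fun A f \<Longrightarrow> smooth_fun A g \<Longrightarrow> smooth_fun A (\<lambda>p. f p * g p)"
  by (rule smooth_funI, rule smooth_on_mult) (auto intro: open_chart_range smooth_fun_chart)

section \<open>Smooth families of self-maps\<close>

text \<open>Smoothness is local, so a neighbourhood chosen separately for each point suffices. This
  leaves room to pass through an auxiliary chart that depends on the point.\<close>

lemma smooth_map_familyI:
  assumes "continuous_on (J \<times> UNIV) (\<lambda>(s, p). H s p)"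
    and "\<And>U x V y s \<xi>. (U, x) \<in> A \<Longrightarrow> (V, y) \<in> A \<Longrightarrow> s \<in> J \<Longrightarrow> \<xi> \<in> x ` U \<Longrightarrow>
      H s (inv_into U x \<xi>) \<in> V \<Longrightarrow>
      \<exists>N. open N \<and> (s, \<xi>) \<in> N \<and> smooth_on N (\<lambda>z. y (H (fst z) (inv_into U x (snd z))))"
  shows "smooth_map_family A J H"
  unfolding smooth_map_family_def
proof (intro conjI assms(1), clarify)
  fix U x V y assume c: "(U, x) \<in> A" "(V, y) \<in> A"
  have "smooth_on {(s, \<xi>). s \<in> J \<and> \<xi> \<in> x ` (U \<inter> H s -` V)} (\<lambda>z. y (H (fst z) (inv_into U x (snd z))))"
    by (rule smooth_on_locally)
       (use assms(2)[OF c] in \<open>auto simp: chart_image_Int_iff[OF c(1)] simp del: image_iff\<close>)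
  then show "smooth_on {(s, \<xi>). s \<in> J \<and> \<xi> \<in> x ` (U \<inter> H s -` V)}
      (\<lambda>(s, \<xi>). local_rep (U, x) (y \<circ> H s) \<xi>)"
    by (simp add: case_prod_unfold)
qed

context
  fixes J :: "real set" and H :: "real \<Rightarrow> 'm \<Rightarrow> 'm"
  assumes H: "smooth_map_family A J H" and J: "open J"
begin

lemma smooth_map_family_continuous: "continuous_on (J \<times> UNIV) (\<lambda>z. H (fst z) (snd z))"
  using H by (simp add: smooth_map_family_def case_prod_unfold)

lemma smooth_map_family_chart:
  assumes "(U, x) \<in> A" "(V, y) \<in> A"
  shows "smooth_on {z. fst z \<in> J \<and> snd z \<in> x ` U \<and> H (fst z) (inv_into U x (snd z)) \<in> V}
           (\<lambda>z. y (H (fst z) (inv_into U x (snd z))))"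
proof -
  have "smooth_on {(s, \<xi>). s \<in> J \<and> \<xi> \<in> x ` (U \<inter> H s -` V)}
      (\<lambda>(s, \<xi>). local_rep (U, x) (y \<circ> H s) \<xi>)"
    using H assms unfolding smooth_map_family_def by blast
  then show ?thesis by (simp add: case_prod_unfold chart_image_Int_iff[OF assms(1)])
qed

text \<open>Joint continuity of the family makes the domain of its coordinate expression open, as
  the rules for composing smooth maps require.\<close>

lemma open_smooth_map_family_domain:
  assumes "(U, x) \<in> A" "open V"
  shows "open {z. fst z \<in> J \<and> snd z \<in> x ` U \<and> H (fst z) (inv_into U x (snd z)) \<in> V}"
proof -
  have "continuous_on (J \<times> x ` U) (\<lambda>z. (fst z, inv_into U x (snd z)))"
    by (intro continuous_on_Pair continuous_on_fst continuous_on_id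
        continuous_on_compose2[OF continuous_on_chart_inverse[OF assms(1)]
          continuous_on_snd[OF continuous_on_id]]) auto
  from continuous_on_compose2[OF smooth_map_family_continuous this]
  have "continuous_on (J \<times> x ` U) (\<lambda>z. H (fst z) (inv_into U x (snd z)))"
    by (simp add: image_subset_iff)
  from continuous_open_preimage[OF this _ assms(2)] J open_chart_range[OF assms(1)]
  have "open (J \<times> x ` U \<inter> (\<lambda>z. H (fst z) (inv_into U x (snd z))) -` V)"
    by (simp add: open_Times)
  moreover have "J \<times> x ` U \<inter> (\<lambda>z. H (fst z) (inv_into U x (snd z))) -` V =
     {z. fst z \<in> J \<and> snd z \<in> x ` U \<and> H (fst z) (inv_into U x (snd z)) \<in> V}" by auto
  ultimately show ?thesis by simp
qed

lemma smooth_map_family_slice: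
  assumes s: "s \<in> J"
  shows "smooth_map A (H s)"
  unfolding smooth_map_def
proof (intro conjI)
  have "continuous_on UNIV (\<lambda>p. H s p)"
    by (rule continuous_on_compose2[OF smooth_map_family_continuous, of _ "\<lambda>p. (s, p)", simplified])
       (use s in \<open>auto intro!: continuous_intros\<close>)
  then show "continuous_on UNIV (H s)" by simp
  show "\<forall>(U, x)\<in>A. \<forall>(V, y)\<in>A. smooth_on (x ` (U \<inter> H s -` V)) (local_rep (U, x) (y \<circ> H s))"
  proof clarify
    fix U x V y assume c: "(U, x) \<in> A" "(V, y) \<in> A"
    let ?S = "{z. fst z \<in> J \<and> snd z \<in> x ` U \<and> H (fst z) (inv_into U x (snd z)) \<in> V}"
    let ?T = "Pair s -` ?S"
    have S: "open ?S" by (rule open_smooth_map_family_domain[OF c(1) open_chart_domain[OF c(2)]])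
    have T: "open ?T" by (rule open_vimage[OF S]) (intro continuous_intros)
    have "smooth_on ?T (\<lambda>\<xi>. (\<lambda>z. y (H (fst z) (inv_into U x (snd z)))) (s, \<xi>))"
      by (rule smooth_on_compose[OF T S _ smooth_map_family_chart[OF c]])
         (simp, rule smooth_on_Pair[OF T smooth_on_const[OF T] smooth_on_ident[OF T]])
    then have "smooth_on ?T (\<lambda>\<xi>. y (H s (inv_into U x \<xi>)))" by simp
    then have "smooth_on (x ` (U \<inter> H s -` V)) (\<lambda>\<xi>. y (H s (inv_into U x \<xi>)))"
      by (rule smooth_on_subset) (use s in \<open>auto simp: chart_inverse[OF c(1)]\<close>)
    then show "smooth_on (x ` (U \<inter> H s -` V)) (local_rep (U, x) (y \<circ> H s))"
      by (simp add: local_rep_def comp_def)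
  qed
qed

end

lemma smooth_map_family_id: "open J \<Longrightarrow> smooth_map_family A J (\<lambda>s. id)"
proof (rule smooth_map_familyI)
  fix U x V y and s :: real and \<xi>
  assume J: "open J" and c: "(U, x) \<in> A" "(V, y) \<in> A" and s: "s \<in> J" "\<xi> \<in> x ` U" "id (inv_into U x \<xi>) \<in> V"
  have T: "open (x ` (U \<inter> V))"
    using open_chart_image[OF c(1)] open_chart_domain[OF c(1)] open_chart_domain[OF c(2)]
    by (simp add: open_Int)
  have "smooth_on (UNIV \<times> x ` (U \<inter> V)) (\<lambda>z::real \<times> _. y (inv_into U x (snd z)))"
    by (rule smooth_on_compose[OF _ T _ smooth_on_transition[OF c]])
       (auto intro!: open_Times smooth_on_snd T)
  moreover have "\<xi> \<in> x ` (U \<inter> V)" using s by (simp add: chart_image_Int_iff[OF c(1)])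
  ultimately show "\<exists>N. open N \<and> (s, \<xi>) \<in> N \<and> smooth_on N (\<lambda>z. y (id (inv_into U x (snd z))))"
    using T by (intro exI[of _ "UNIV \<times> x ` (U \<inter> V)"]) (auto simp: open_Times)
qed (auto intro!: continuous_intros simp: case_prod_unfold)

text \<open>Near a given point the coordinate expression factors through a chart around the
  intermediate point. The inner map \<open>\<theta>\<close> carries the parameter along, so both
  factors are smooth maps in parameter and coordinates jointly.\<close>

lemma smooth_map_family_compose:
  assumes J: "open J" and F: "smooth_map_family A J F" and G: "smooth_map_family A J G"
  shows "smooth_map_family A J (\<lambda>s. G s \<circ> F s)"
proof (rule smooth_map_familyI)
  have "continuous_on (J \<times> UNIV) (\<lambda>z. G (fst z) (F (fst z) (snd z)))"
    by (rule continuous_on_compose2[OF smooth_map_family_continuous[OF G], of _ "\<lambda>z. (fst z, F (fst z) (snd z))", simplified])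
       (auto intro!: continuous_intros smooth_map_family_continuous[OF F] J)
  then show "continuous_on (J \<times> UNIV) (\<lambda>(s, p). (G s \<circ> F s) p)" by (simp add: case_prod_unfold)
  fix U x V y s \<xi>
  assume c: "(U, x) \<in> A" "(V, y) \<in> A" and s: "s \<in> J" "\<xi> \<in> x ` U" "(G s \<circ> F s) (inv_into U x \<xi>) \<in> V"
  obtain W z where w: "(W, z) \<in> A" "F s (inv_into U x \<xi>) \<in> W" by (rule chart_cover)
  define M1 where "M1 = {a. fst a \<in> J \<and> snd a \<in> x ` U \<and> F (fst a) (inv_into U x (snd a)) \<in> W}"
  define M2 where "M2 = {a. fst a \<in> J \<and> snd a \<in> z ` W \<and> G (fst a) (inv_into W z (snd a)) \<in> V}"
  define \<theta> where "\<theta> a = (fst a, z (F (fst a) (inv_into U x (snd a))))" for a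
  have M1: "open M1" and M2: "open M2"
    unfolding M1_def M2_def
    by (rule open_smooth_map_family_domain[OF F J c(1) open_chart_domain[OF w(1)]]
        open_smooth_map_family_domain[OF G J w(1) open_chart_domain[OF c(2)]])+
  have \<theta>: "smooth_on M1 \<theta>"
    unfolding \<theta>_def[abs_def]
    by (intro smooth_on_Pair M1 smooth_on_fst)
       (use smooth_map_family_chart[OF F J c(1) w(1)] in \<open>simp add: M1_def\<close>)
  have N: "open (M1 \<inter> \<theta> -` M2)"
    using continuous_open_preimage[OF smooth_on_continuous_on[OF \<theta>] M1 M2] .
  have "smooth_on (M1 \<inter> \<theta> -` M2) (\<lambda>a. (\<lambda>b. y (G (fst b) (inv_into W z (snd b)))) (\<theta> a))"
    by (rule smooth_on_compose[OF N M2])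
       (use smooth_map_family_chart[OF G J w(1) c(2)] smooth_on_subset[OF \<theta>] in \<open>auto simp: M2_def\<close>)
  then have "smooth_on (M1 \<inter> \<theta> -` M2) (\<lambda>a. y ((G (fst a) \<circ> F (fst a)) (inv_into U x (snd a))))"
    by (rule smooth_on_cong[OF N, rotated]) (auto simp: \<theta>_def M1_def chart_inverse[OF w(1)])
  moreover have "(s, \<xi>) \<in> M1 \<inter> \<theta> -` M2"
    using s w by (auto simp: M1_def M2_def \<theta>_def chart_inverse[OF w(1)])
  ultimately show "\<exists>N. open N \<and> (s, \<xi>) \<in> N \<and>
      smooth_on N (\<lambda>a. y ((G (fst a) \<circ> F (fst a)) (inv_into U x (snd a))))"
    using N by blast
qed

section \<open>Extending chart constructions to the manifold\<close>

text \<open>The continuous inverse of the chart carries \<open>K\<close> to this set. In a Hausdorff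
  space it is then closed, so its complement can serve as the second open piece when gluing.\<close>

lemma compact_chart_vimage:
  assumes "(U, x) \<in> A" "compact K" "K \<subseteq> x ` U"
  shows "compact {p \<in> U. x p \<in> K}"
  using compact_continuous_image[OF continuous_on_subset[OF continuous_on_chart_inverse[OF assms(1)] assms(3)] assms(2)]
  by (simp add: chart_vimage_eq[OF assms(1,3)])

text \<open>The manifold is covered by \<open>U\<close> and the complement of the preimage of
  \<open>K\<close>. Both are open, and the function is smooth on the first and zero on the
  second.\<close>

lemma smooth_fun_extend_by_zero:
  assumes c: "(U, x) \<in> A" and K: "compact K" "K \<subseteq> x ` U" and \<beta>: "smooth_on UNIV \<beta>"
    and zero: "\<And>\<xi>. \<xi> \<notin> K \<Longrightarrow> \<beta> \<xi> = 0"
  shows "smooth_fun A (\<lambda>p. if p \<in> U then \<beta> (x p) else 0)"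
proof (rule smooth_funI, rule smooth_on_locally)
  fix V y \<xi> assume d: "(V, y) \<in> A" and \<xi>: "\<xi> \<in> y ` V"
  let ?f = "\<lambda>\<xi>. if inv_into V y \<xi> \<in> U then \<beta> (x (inv_into V y \<xi>)) else 0"
  define L where "L = {p \<in> U. x p \<in> K}"
  have L: "closed L" unfolding L_def by (intro compact_imp_closed compact_chart_vimage[OF c K])
  show "\<exists>N. open N \<and> \<xi> \<in> N \<and> smooth_on N ?f"
  proof (cases "inv_into V y \<xi> \<in> U")
    case True
    have N: "open (y ` (V \<inter> U))"
      using open_chart_image[OF d] open_chart_domain[OF d] open_chart_domain[OF c] by (simp add: open_Int)
    have "smooth_on (y ` (V \<inter> U)) (\<lambda>\<xi>. \<beta> (x (inv_into V y \<xi>)))"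
      by (rule smooth_on_compose[OF N open_UNIV _ \<beta> smooth_on_transition[OF d c]]) simp
    then have "smooth_on (y ` (V \<inter> U)) ?f"
      by (rule smooth_on_cong[OF N, rotated]) (auto simp: chart_inverse[OF d])
    moreover have "\<xi> \<in> y ` (V \<inter> U)" using \<xi> True by (simp add: chart_image_Int_iff[OF d])
    ultimately show ?thesis using N by blast
  next
    case False
    have N: "open (y ` (V \<inter> - L))"
      using L by (intro open_chart_image[OF d] open_Int open_chart_domain[OF d]) auto
    have "smooth_on (y ` (V \<inter> - L)) ?f"
      by (rule smooth_on_cong[OF N _ smooth_on_const[OF N, of 0]])
         (use zero in \<open>fastforce simp: chart_inverse[OF d] L_def\<close>)
    moreover have "\<xi> \<in> y ` (V \<inter> - L)" using \<xi> False by (simp add: chart_image_Int_iff[OF d] L_def)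
    ultimately show ?thesis using N by blast
  qed
qed

definition extend_by_id ::
  "'m set \<Rightarrow> ('m \<Rightarrow> real^'n) \<Rightarrow> (real^'n) set \<Rightarrow> (real \<times> (real^'n) \<Rightarrow> real^'n) \<Rightarrow> real \<Rightarrow> 'm \<Rightarrow> 'm" where
  "extend_by_id U x B \<eta> s p = (if p \<in> U \<and> x p \<in> B then inv_into U x (\<eta> (s, x p)) else p)"

text \<open>Two open pieces again: on \<open>P\<close> the family is given by \<open>\<eta>\<close>
  in the chart, off \<open>L\<close> it is the identity. They cover because K lies in B, and they
  agree on the overlap because \<open>\<eta>\<close> fixes the points outside K.\<close>

lemma smooth_map_family_extend_by_id:
  assumes J: "open J" and c: "(U, x) \<in> A" and B: "open B" "B \<subseteq> x ` U" and K: "compact K" "K \<subseteq> B"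
    and \<eta>: "smooth_on (J \<times> B) \<eta>" and mem: "\<And>s \<xi>. s \<in> J \<Longrightarrow> \<xi> \<in> B \<Longrightarrow> \<eta> (s, \<xi>) \<in> B"
    and off: "\<And>s \<xi>. s \<in> J \<Longrightarrow> \<xi> \<in> B \<Longrightarrow> \<xi> \<notin> K \<Longrightarrow> \<eta> (s, \<xi>) = \<xi>"
  shows "smooth_map_family A J (extend_by_id U x B \<eta>)"
proof (rule smooth_map_familyI)
  let ?H = "extend_by_id U x B \<eta>"
  define P L where "P = {p \<in> U. x p \<in> B}" and "L = {p \<in> U. x p \<in> K}"
  have P: "open P" unfolding P_def by (rule open_chart_vimage[OF c B(1)])
  have L: "closed L"
    unfolding L_def using K B by (intro compact_imp_closed compact_chart_vimage[OF c]) auto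
  have JB: "open (J \<times> B)" using J B by (simp add: open_Times)
  have HP: "?H s p = inv_into U x (\<eta> (s, x p))" if "p \<in> P" for s p
    using that by (simp add: extend_by_id_def P_def)
  have HL: "?H s p = p" if "p \<notin> L" "s \<in> J" for s p
    using that off chart_inverse[OF c] by (auto simp: extend_by_id_def L_def)
  have cont_\<eta>: "continuous_on (J \<times> P) (\<lambda>z. \<eta> (fst z, x (snd z)))"
    by (rule continuous_on_compose2[OF smooth_on_continuous_on[OF \<eta>]])
       (auto simp: P_def intro!: continuous_intros continuous_on_compose2[OF continuous_on_chart[OF c]])
  have "continuous_on (J \<times> P) (\<lambda>z. inv_into U x (\<eta> (fst z, x (snd z))))"
    by (rule continuous_on_compose2[OF continuous_on_chart_inverse[OF c] cont_\<eta>])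
       (use mem B in \<open>auto simp: P_def\<close>)
  then have "continuous_on (J \<times> P) (\<lambda>z. ?H (fst z) (snd z))"
    by (rule continuous_on_eq) (auto simp: HP)
  moreover have "continuous_on (J \<times> - L) (\<lambda>z. ?H (fst z) (snd z))"
    by (rule continuous_on_eq[OF continuous_on_snd[OF continuous_on_id]]) (auto simp: HL)
  moreover have "open (J \<times> P)" "open (J \<times> - L)" using J P L by (auto simp: open_Times open_Compl)
  ultimately have "continuous_on (J \<times> P \<union> J \<times> - L) (\<lambda>z. ?H (fst z) (snd z))"
    by (intro continuous_on_open_Un)
  moreover have "J \<times> P \<union> J \<times> - L = J \<times> UNIV" using K by (auto simp: P_def L_def)
  ultimately show "continuous_on (J \<times> UNIV) (\<lambda>(s, p). ?H s p)" by (simp add: case_prod_unfold)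
  fix V y W z s \<xi>
  assume d: "(V, y) \<in> A" and e: "(W, z) \<in> A" and s: "s \<in> J" "\<xi> \<in> y ` V"
    and W: "?H s (inv_into V y \<xi>) \<in> W"
  show "\<exists>N. open N \<and> (s, \<xi>) \<in> N \<and> smooth_on N (\<lambda>a. z (?H (fst a) (inv_into V y (snd a))))"
  proof (cases "inv_into V y \<xi> \<in> P")
    case True
    define T where "T = x ` (U \<inter> W)"
    have T: "open T"
      unfolding T_def using open_chart_image[OF c] open_chart_domain[OF c] open_chart_domain[OF e]
      by (simp add: open_Int)
    define Q where "Q = y ` (V \<inter> P)"
    have Q: "open Q"
      unfolding Q_def using open_chart_image[OF d] open_chart_domain[OF d] P by (simp add: open_Int)
    have JQ: "open (J \<times> Q)" using J Q by (simp add: open_Times)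
    have tr: "smooth_on Q (\<lambda>\<xi>. x (inv_into V y \<xi>))"
      by (rule smooth_on_subset[OF smooth_on_transition[OF d c]]) (auto simp: Q_def P_def)
    have trQ: "inv_into V y \<xi> \<in> P" if "\<xi> \<in> Q" for \<xi>
      using that by (auto simp: Q_def chart_inverse[OF d])
    define \<zeta> where "\<zeta> a = \<eta> (fst a, x (inv_into V y (snd a)))" for a
    have \<zeta>: "smooth_on (J \<times> Q) \<zeta>"
      unfolding \<zeta>_def[abs_def]
    proof (rule smooth_on_compose[OF JQ JB _ \<eta>])
      show "smooth_on (J \<times> Q) (\<lambda>a. (fst a, x (inv_into V y (snd a))))"
        by (intro smooth_on_Pair JQ smooth_on_fst smooth_on_compose[OF JQ Q _ tr] smooth_on_snd) auto
    qed (use trQ in \<open>auto simp: P_def\<close>)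
    \<comment> \<open>The neighbourhood is shrunk until the moved point lies in the target chart,
      where the transition map can be applied.\<close>
    define N where "N = J \<times> Q \<inter> \<zeta> -` T"
    have N: "open N"
      unfolding N_def by (rule continuous_open_preimage[OF smooth_on_continuous_on[OF \<zeta>] JQ T])
    have "smooth_on N (\<lambda>a. z (inv_into U x (\<zeta> a)))"
      by (rule smooth_on_compose[OF N T])
         (use smooth_on_transition[OF c e] smooth_on_subset[OF \<zeta>] in \<open>auto simp: N_def T_def\<close>)
    then have "smooth_on N (\<lambda>a. z (?H (fst a) (inv_into V y (snd a))))"
      by (rule smooth_on_cong[OF N, rotated]) (auto simp: HP trQ \<zeta>_def N_def)
    moreover have "(s, \<xi>) \<in> N"
    proof -
      have q: "\<xi> \<in> Q" using s True by (simp add: Q_def chart_image_Int_iff[OF d])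
      have m: "\<zeta> (s, \<xi>) \<in> x ` U" using mem[OF s(1)] True B by (auto simp: \<zeta>_def P_def)
      have "inv_into U x (\<zeta> (s, \<xi>)) \<in> W" using W by (simp add: HP[OF True] \<zeta>_def)
      then have "\<zeta> (s, \<xi>) \<in> T"
        using m chart_inverse_mem[OF c m] by (simp add: T_def chart_image_Int_iff[OF c])
      then show ?thesis using q s by (simp add: N_def)
    qed
    ultimately show ?thesis using N by blast
  next
    case False
    define Q where "Q = y ` (V \<inter> (W - L))"
    have Q: "open Q"
      unfolding Q_def
      by (intro open_chart_image[OF d] open_Int open_Diff open_chart_domain[OF d] open_chart_domain[OF e] L) auto
    have JQ: "open (J \<times> Q)" using J Q by (simp add: open_Times)
    have tr: "smooth_on Q (\<lambda>\<xi>. z (inv_into V y \<xi>))"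
      by (rule smooth_on_subset[OF smooth_on_transition[OF d e]]) (auto simp: Q_def)
    have "smooth_on (J \<times> Q) (\<lambda>a. z (inv_into V y (snd a)))"
      by (rule smooth_on_compose[OF JQ Q _ tr smooth_on_snd[OF JQ]]) auto
    then have "smooth_on (J \<times> Q) (\<lambda>a. z (?H (fst a) (inv_into V y (snd a))))"
      by (rule smooth_on_cong[OF JQ, rotated]) (auto simp: Q_def chart_inverse[OF d] HL)
    moreover have "inv_into V y \<xi> \<notin> L" using False K by (auto simp: P_def L_def)
    then have "\<xi> \<in> Q" using s W HL by (simp add: Q_def chart_image_Int_iff[OF d])
    ultimately show ?thesis using JQ s by blast
  qed
qed

end

section \<open>Isotopies and nodal sets\<close>

lemma homeomorphism_components:
  assumes "homeomorphism S T f g"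
  shows "components T = (`) f ` components S"
proof -
  have "T = f ` S" using homeomorphism_image1[OF assms] by simp
  then show ?thesis
    using connected_component_set_homeomorphism[OF assms]
    by (auto simp: components_def image_image intro!: image_cong)
qed

text \<open>\<open>f\<close> restricts to a homeomorphism between the complements of the nodal sets
  and so carries components to components. Taking images under an injective map is injective on
  sets, which preserves both finiteness and cardinality.\<close>

lemma homeomorphism_nodal_count:
  assumes f: "continuous_on UNIV f" "continuous_on UNIV g" "g \<circ> f = id" "f \<circ> g = id"
    and img: "f ` nodal_set u = nodal_set w"
  shows "nodal_count u = nodal_count w"
proof -
  have gf: "g (f p) = p" "f (g q) = q" for p q using f(3,4) by (metis comp_apply id_apply)+
  have mem: "p \<in> nodal_set u \<longleftrightarrow> f p \<in> nodal_set w" for p using img gf by (metis image_iff)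
  have "homeomorphism (- nodal_set u) (- nodal_set w) f g"
    using f(1,2) gf mem
    by (intro homeomorphismI) (auto intro: continuous_on_subset)
  then have c: "components (- nodal_set w) = (`) f ` components (- nodal_set u)"
    by (rule homeomorphism_components)
  have "inj f" using gf by (metis injI)
  then have "inj_on ((`) f) X" for X by (simp add: inj_on_def inj_image_eq_iff)
  then show ?thesis
    unfolding nodal_count_def c Let_def by (simp add: finite_image_iff card_image)
qed

context smooth_manifold
begin

text \<open>Carrying the inverse family along makes the relation transitive without an inverse function
  theorem on the manifold.\<close>

definition invertibly_isotopic :: "'m set \<Rightarrow> 'm set \<Rightarrow> bool" where
  "invertibly_isotopic S T \<longleftrightarrow> (\<exists>H G.
     smooth_map_family A {-1<..<2} H \<and> smooth_map_family A {-1<..<2} G \<and>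
     (\<forall>s\<in>{-1<..<2}. G s \<circ> H s = id \<and> H s \<circ> G s = id) \<and> H 0 = id \<and> H 1 ` S = T)"

lemma invertibly_isotopic_refl: "invertibly_isotopic S S"
  unfolding invertibly_isotopic_def
  by (intro exI[of _ "\<lambda>s. id"]) (simp add: smooth_map_family_id)

text \<open>The two families are composed at each parameter value rather than run one after the
  other, so no smoothing at a junction arises.\<close>

lemma invertibly_isotopic_trans:
  assumes "invertibly_isotopic S T" "invertibly_isotopic T R"
  shows "invertibly_isotopic S R"
proof -
  obtain H G where 1: "smooth_map_family A {-1<..<2} H" "smooth_map_family A {-1<..<2} G"
    "\<And>s. s \<in> {-1<..<2} \<Longrightarrow> G s \<circ> H s = id \<and> H s \<circ> G s = id" "H 0 = id" "H 1 ` S = T"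
    using assms(1) unfolding invertibly_isotopic_def by blast
  obtain H' G' where 2: "smooth_map_family A {-1<..<2} H'" "smooth_map_family A {-1<..<2} G'"
    "\<And>s. s \<in> {-1<..<2} \<Longrightarrow> G' s \<circ> H' s = id \<and> H' s \<circ> G' s = id" "H' 0 = id" "H' 1 ` T = R"
    using assms(2) unfolding invertibly_isotopic_def by blast
  have "(G s \<circ> G' s) \<circ> (H' s \<circ> H s) = id \<and> (H' s \<circ> H s) \<circ> (G s \<circ> G' s) = id"
    if "s \<in> {-1<..<2}" for s
    using 1(3)[OF that] 2(3)[OF that] by (auto simp: fun_eq_iff)
  then show ?thesis
    unfolding invertibly_isotopic_def
    using smooth_map_family_compose[OF _ 1(1) 2(1)] smooth_map_family_compose[OF _ 2(2) 1(2)] 1 2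
    by (intro exI[of _ "\<lambda>s. H' s \<circ> H s"] exI[of _ "\<lambda>s. G s \<circ> G' s"]) (auto simp: image_comp[symmetric])
qed

text \<open>\<open>G s\<close> is the inverse of \<open>H s\<close>, so smoothness of the inverse is
  smoothness of a slice of the second family.\<close>

lemma invertibly_isotopic_imp_ambiently_isotopic:
  assumes "invertibly_isotopic S T"
  shows "ambiently_isotopic A S T"
proof -
  obtain H G where 1: "smooth_map_family A {-1<..<2} H" "smooth_map_family A {-1<..<2} G"
    "\<And>s. s \<in> {-1<..<2} \<Longrightarrow> G s \<circ> H s = id \<and> H s \<circ> G s = id" "H 0 = id" "H 1 ` S = T"
    using assms(1) unfolding invertibly_isotopic_def by blast
  have "diffeomorphism A (H s)" if "s \<in> {0..1}" for s
  proof -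
    have s: "s \<in> {-1<..<2}" using that by auto
    have "bij (H s)" "inv (H s) = G s"
      using 1(3)[OF s] o_bij inv_unique_comp by metis+
    then show ?thesis
      unfolding diffeomorphism_def
      using smooth_map_family_slice[OF 1(1) _ s] smooth_map_family_slice[OF 1(2) _ s] by simp
  qed
  then show ?thesis
    unfolding ambiently_isotopic_def using 1 by (intro exI[of _ "{-1<..<2}"] exI[of _ H]) auto
qed

lemma invertibly_isotopic_nodal_count:
  assumes "invertibly_isotopic (nodal_set u) (nodal_set w)"
  shows "nodal_count u = nodal_count w"
proof -
  obtain H G where 1: "smooth_map_family A {-1<..<2} H" "smooth_map_family A {-1<..<2} G"
    "\<And>s. s \<in> {-1<..<2} \<Longrightarrow> G s \<circ> H s = id \<and> H s \<circ> G s = id"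
    "H 1 ` nodal_set u = nodal_set w"
    using assms(1) unfolding invertibly_isotopic_def by blast
  have "smooth_map A (H 1)" "smooth_map A (G 1)"
    using smooth_map_family_slice[OF 1(1), of 1] smooth_map_family_slice[OF 1(2), of 1] by auto
  then show ?thesis
    using 1(3)[of 1] 1(4) by (intro homeomorphism_nodal_count[of "H 1" "G 1"]) (auto simp: smooth_map_def)
qed

section \<open>Perturbations small in C^1\<close>

text \<open>Convergence to 0 in C^1, uniform on compact sets in charts. The direction is fixed
  before the filter acts, which suits boxes that each slide along a single direction.\<close>

definition C1_null :: "('i \<Rightarrow> 'm \<Rightarrow> real) \<Rightarrow> 'i filter \<Rightarrow> bool" where
  "C1_null d F \<longleftrightarrow> (\<forall>U x K v \<epsilon>. (U, x) \<in> A \<longrightarrow> compact K \<longrightarrow> K \<subseteq> x ` U \<longrightarrow> \<epsilon> > 0 \<longrightarrow>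
     (\<forall>\<^sub>F t in F. \<forall>\<xi>\<in>K. \<bar>d t (inv_into U x \<xi>)\<bar> < \<epsilon> \<and>
        \<bar>frechet_derivative (\<lambda>\<xi>. d t (inv_into U x \<xi>)) (at \<xi>) v\<bar> < \<epsilon>))"

lemma C1_nullD:
  assumes "C1_null d F" "(U, x) \<in> A" "compact K" "K \<subseteq> x ` U" "\<epsilon> > 0"
  shows "\<forall>\<^sub>F t in F. \<forall>\<xi>\<in>K. \<bar>d t (inv_into U x \<xi>)\<bar> < \<epsilon> \<and>
        \<bar>frechet_derivative (\<lambda>\<xi>. d t (inv_into U x \<xi>)) (at \<xi>) v\<bar> < \<epsilon>"
  using assms unfolding C1_null_def by blast

text \<open>The product rule, with \<sigma> and its derivative bounded on the compact set. It makes
  the remainder left by one correction a legitimate perturbation for the next.\<close>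

lemma C1_null_mult:
  assumes d: "C1_null d F" and smooth: "\<forall>\<^sub>F t in F. smooth_fun A (d t)" and \<sigma>: "smooth_fun A \<sigma>"
  shows "C1_null (\<lambda>t p. \<sigma> p * d t p) F"
  unfolding C1_null_def
proof (intro allI impI)
  fix U x K v and \<epsilon> :: real
  assume c: "(U, x) \<in> A" and K: "compact K" "K \<subseteq> x ` U" and \<epsilon>: "\<epsilon> > 0"
  let ?\<sigma> = "\<lambda>\<xi>. \<sigma> (inv_into U x \<xi>)"
  have s: "smooth_on (x ` U) ?\<sigma>" by (rule smooth_fun_chart[OF \<sigma> c])
  have "bounded (?\<sigma> ` K)" "bounded ((\<lambda>\<xi>. frechet_derivative ?\<sigma> (at \<xi>) v) ` K)"
    using smooth_on_continuous_on[OF s] smooth_on_continuous_on[OF smooth_on_deriv[OF s]] K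
    by (auto intro!: compact_imp_bounded compact_continuous_image intro: continuous_on_subset)
  then obtain B1 B2 where B: "\<And>\<xi>. \<xi> \<in> K \<Longrightarrow> \<bar>?\<sigma> \<xi>\<bar> \<le> B1"
    "\<And>\<xi>. \<xi> \<in> K \<Longrightarrow> \<bar>frechet_derivative ?\<sigma> (at \<xi>) v\<bar> \<le> B2"
    unfolding bounded_iff by auto
  \<comment> \<open>The summand 1 keeps \<open>B\<close> positive and leaves a slack of \<epsilon> /
    B, which makes the final inequality strict.\<close>
  define B where "B = \<bar>B1\<bar> + \<bar>B2\<bar> + 1"
  have "B > 0" by (simp add: B_def)
  have "\<epsilon> / B > 0" using \<open>B > 0\<close> \<epsilon> by simp
  from C1_nullD[OF d c K this, of v] smooth
  show "\<forall>\<^sub>F t in F. \<forall>\<xi>\<in>K. \<bar>\<sigma> (inv_into U x \<xi>) * d t (inv_into U x \<xi>)\<bar> < \<epsilon> \<and>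
      \<bar>frechet_derivative (\<lambda>\<xi>. \<sigma> (inv_into U x \<xi>) * d t (inv_into U x \<xi>)) (at \<xi>) v\<bar> < \<epsilon>"
  proof eventually_elim
    case (elim t)
    show ?case
    proof
      fix \<xi> assume \<xi>: "\<xi> \<in> K"
      let ?d = "\<lambda>\<xi>. d t (inv_into U x \<xi>)"
      let ?D = "frechet_derivative ?d (at \<xi>) v" and ?S = "frechet_derivative ?\<sigma> (at \<xi>) v"
      have small: "\<bar>?d \<xi>\<bar> < \<epsilon> / B" "\<bar>?D\<bar> < \<epsilon> / B" using elim(1) \<xi> \<epsilon> \<open>B > 0\<close> by auto
      have sd: "\<bar>?\<sigma> \<xi>\<bar> * (\<epsilon> / B) \<le> \<bar>B1\<bar> * (\<epsilon> / B)" "\<bar>?S\<bar> * (\<epsilon> / B) \<le> \<bar>B2\<bar> * (\<epsilon> / B)"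
        by (rule mult_right_mono; use B[OF \<xi>] \<epsilon> \<open>B > 0\<close> in force)+
      have p: "\<bar>?\<sigma> \<xi>\<bar> * \<bar>?d \<xi>\<bar> \<le> \<bar>?\<sigma> \<xi>\<bar> * (\<epsilon> / B)" "\<bar>?\<sigma> \<xi>\<bar> * \<bar>?D\<bar> \<le> \<bar>?\<sigma> \<xi>\<bar> * (\<epsilon> / B)"
        "\<bar>?S\<bar> * \<bar>?d \<xi>\<bar> \<le> \<bar>?S\<bar> * (\<epsilon> / B)"
        by (rule mult_left_mono; use small in force)+
      have tot: "\<bar>B1\<bar> * (\<epsilon> / B) + \<bar>B2\<bar> * (\<epsilon> / B) < \<epsilon>"
      proof -
        have "\<bar>B1\<bar> * (\<epsilon> / B) + \<bar>B2\<bar> * (\<epsilon> / B) + \<epsilon> / B = B * (\<epsilon> / B)"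
          by (simp only: B_def distrib_right mult_1)
        moreover have "B * (\<epsilon> / B) = \<epsilon>" "\<epsilon> / B > 0" using \<open>B > 0\<close> \<epsilon> by auto
        ultimately show ?thesis by linarith
      qed
      have nn: "0 \<le> \<bar>B2\<bar> * (\<epsilon> / B)" using \<open>B > 0\<close> \<epsilon> by simp
      have "\<xi> \<in> x ` U" using K \<xi> by auto
      then have "((\<lambda>\<xi>. ?\<sigma> \<xi> * ?d \<xi>) has_derivative
          (\<lambda>v. ?\<sigma> \<xi> * frechet_derivative ?d (at \<xi>) v + frechet_derivative ?\<sigma> (at \<xi>) v * ?d \<xi>)) (at \<xi>)"
        by (intro has_derivative_mult smooth_on_has_derivative[OF s]
            smooth_on_has_derivative[OF smooth_fun_chart[OF elim(2) c]])
      from frechet_derivative_at[OF this, symmetric]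
      have "frechet_derivative (\<lambda>\<xi>. ?\<sigma> \<xi> * ?d \<xi>) (at \<xi>) v = ?\<sigma> \<xi> * ?D + ?S * ?d \<xi>" by simp
      also have "\<bar>\<dots>\<bar> \<le> \<bar>?\<sigma> \<xi>\<bar> * \<bar>?D\<bar> + \<bar>?S\<bar> * \<bar>?d \<xi>\<bar>"
        by (rule order_trans[OF abs_triangle_ineq]) (simp add: abs_mult)
      finally show "\<bar>?\<sigma> \<xi> * ?d \<xi>\<bar> < \<epsilon> \<and> \<bar>frechet_derivative (\<lambda>\<xi>. ?\<sigma> \<xi> * ?d \<xi>) (at \<xi>) v\<bar> < \<epsilon>"
        using p sd tot nn unfolding abs_mult by linarith
    qed
  qed
qed

section \<open>Bumps and local corrections\<close>

lemma chart_bump_exists: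
  assumes c: "(U, x) \<in> A" "p \<in> U" and r: "r > 0" "cball (x p) r \<subseteq> x ` U"
  obtains \<rho> W where "smooth_fun A \<rho>" "\<And>q. 0 \<le> \<rho> q" "\<And>q. \<rho> q \<le> 1"
    "open W" "p \<in> W" "\<And>q. q \<in> W \<Longrightarrow> \<rho> q = 1" "W \<subseteq> {q \<in> U. x q \<in> cball (x p) r}"
    "\<And>q. \<rho> q \<noteq> 0 \<Longrightarrow> q \<in> U \<and> x q \<in> cball (x p) r"
proof -
  obtain \<beta> :: "real^'n \<Rightarrow> real" where \<beta>: "smooth_on UNIV \<beta>" "\<And>\<xi>. 0 \<le> \<beta> \<xi>" "\<And>\<xi>. \<beta> \<xi> \<le> 1"
    "\<And>\<xi>. \<xi> \<in> ball (x p) (r / 2) \<Longrightarrow> \<beta> \<xi> = 1" "\<And>\<xi>. \<xi> \<notin> cball (x p) r \<Longrightarrow> \<beta> \<xi> = 0"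
    using bump_function_exists[OF r(1)] by blast
  show thesis
  proof
    show "smooth_fun A (\<lambda>q. if q \<in> U then \<beta> (x q) else 0)"
      by (rule smooth_fun_extend_by_zero[OF c(1) compact_cball r(2) \<beta>(1,5)])
    show "open {q \<in> U. x q \<in> ball (x p) (r / 2)}"
      by (rule open_chart_vimage[OF c(1) open_ball])
  qed (use \<beta> c r in \<open>auto split: if_splits\<close>)
qed

text \<open>One chart and one direction are enough here, because a box supplies just these;
  \<open>regular_valueI\<close> transfers the property to all charts.\<close>

definition nondegenerate_at :: "('m \<Rightarrow> real) \<Rightarrow> 'm \<Rightarrow> bool" where
  "nondegenerate_at u q \<longleftrightarrow> (\<exists>(U, x)\<in>A. q \<in> U \<and>
     (\<exists>v. frechet_derivative (\<lambda>\<xi>. u (inv_into U x \<xi>)) (at (x q)) v \<noteq> 0))"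

text \<open>Replacing \<open>d\<close> by \<open>(1 - \<rho>) d\<close> removes the perturbation \<open>d\<close> of \<open>f\<close> on \<open>W\<close> without changing the
  isotopy class of the nodal set.\<close>

definition correction_at :: "('m \<Rightarrow> real) \<Rightarrow> 'm set \<Rightarrow> ('m \<Rightarrow> real) \<Rightarrow> bool" where
  "correction_at f W \<rho> \<longleftrightarrow> open W \<and> smooth_fun A \<rho> \<and> (\<forall>q\<in>W. \<rho> q = 1) \<and>
     (\<forall>(F :: real filter) d. C1_null d F \<longrightarrow> (\<forall>\<^sub>F t in F. smooth_fun A (d t)) \<longrightarrow>
        (\<forall>\<^sub>F t in F.
           (\<forall>q\<in>W. f q + d t q = 0 \<longrightarrow> nondegenerate_at (\<lambda>q. f q + d t q) q) \<and>
           invertibly_isotopic (nodal_set (\<lambda>q. f q + d t q))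
             (nodal_set (\<lambda>q. f q + (1 - \<rho> q) * d t q))))"

lemma correction_atD:
  fixes F :: "real filter"
  assumes "correction_at f W \<rho>" "C1_null d F" "\<forall>\<^sub>F t in F. smooth_fun A (d t)"
  shows "\<forall>\<^sub>F t in F. \<forall>q\<in>W. f q + d t q = 0 \<longrightarrow> nondegenerate_at (\<lambda>q. f q + d t q) q"
    and "\<forall>\<^sub>F t in F. invertibly_isotopic (nodal_set (\<lambda>q. f q + d t q))
           (nodal_set (\<lambda>q. f q + (1 - \<rho> q) * d t q))"
  using assms unfolding correction_at_def eventually_conj_iff by blast+

text \<open>Where \<rho> is nonzero, |d| < |f|, and multiplying \<open>d\<close> by a factor in
  [0,1] keeps this, so neither function vanishes; where \<rho> is 0 they coincide. The nodal sets
  are therefore equal. On \<open>W\<close> the perturbed function has no zero, so nondegeneracy is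
  vacuous.\<close>

lemma correction_at_nonzero:
  assumes f: "smooth_fun A f" and p: "f p \<noteq> 0"
  obtains W \<rho> where "correction_at f W \<rho>" "p \<in> W"
proof -
  obtain U x where c: "(U, x) \<in> A" "p \<in> U" by (rule chart_cover)
  let ?f = "\<lambda>\<xi>. f (inv_into U x \<xi>)"
  define a where "a = \<bar>f p\<bar> / 2"
  have a: "a > 0" using p by (simp add: a_def)
  have "isCont ?f (x p)"
    using smooth_on_isCont[OF smooth_fun_chart[OF f c(1)]] c(2) by blast
  then have "((\<lambda>\<xi>. \<bar>?f \<xi>\<bar>) \<longlongrightarrow> \<bar>?f (x p)\<bar>) (nhds (x p))"
    by (intro tendsto_rabs) (simp add: isCont_def tendsto_nhds_iff)
  moreover have "a < \<bar>?f (x p)\<bar>" using a chart_inverse[OF c] by (simp add: a_def)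
  ultimately have "\<forall>\<^sub>F \<xi> in nhds (x p). a < \<bar>?f \<xi>\<bar>" by (rule order_tendstoD)
  moreover have "\<forall>\<^sub>F \<xi> in nhds (x p). \<xi> \<in> x ` U"
    using open_chart_range[OF c(1)] c(2) by (intro eventually_nhds_in_open) auto
  ultimately have "\<forall>\<^sub>F \<xi> in nhds (x p). a < \<bar>?f \<xi>\<bar> \<and> \<xi> \<in> x ` U" by (rule eventually_conj)
  then obtain r where r: "r > 0" "\<And>\<xi>. \<xi> \<in> cball (x p) r \<Longrightarrow> a < \<bar>?f \<xi>\<bar> \<and> \<xi> \<in> x ` U"
    unfolding eventually_nhds_metric_le by (auto simp: dist_commute)
  then have sub: "cball (x p) r \<subseteq> x ` U" by blast
  obtain \<rho> W where \<rho>: "smooth_fun A \<rho>" "\<And>q. 0 \<le> \<rho> q" "\<And>q. \<rho> q \<le> 1"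
    "open W" "p \<in> W" "\<And>q. q \<in> W \<Longrightarrow> \<rho> q = 1" "W \<subseteq> {q \<in> U. x q \<in> cball (x p) r}"
    "\<And>q. \<rho> q \<noteq> 0 \<Longrightarrow> q \<in> U \<and> x q \<in> cball (x p) r"
    by (rule chart_bump_exists[OF c r(1) sub]) blast
  have "correction_at f W \<rho>"
    unfolding correction_at_def
  proof (intro conjI allI impI ballI)
    fix F :: "real filter" and d
    assume d: "C1_null d F"
    let ?good = "\<lambda>t. (\<forall>q\<in>W. f q + d t q = 0 \<longrightarrow> nondegenerate_at (\<lambda>q. f q + d t q) q) \<and>
      invertibly_isotopic (nodal_set (\<lambda>q. f q + d t q)) (nodal_set (\<lambda>q. f q + (1 - \<rho> q) * d t q))"
    show "\<forall>\<^sub>F t in F. ?good t"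
      using C1_nullD[OF d c(1) compact_cball sub a]
    proof eventually_elim
      fix t assume small: "\<forall>\<xi>\<in>cball (x p) r. \<bar>d t (inv_into U x \<xi>)\<bar> < a \<and>
        \<bar>frechet_derivative (\<lambda>\<xi>. d t (inv_into U x \<xi>)) (at \<xi>) undefined\<bar> < a"
      have nz: "\<bar>d t q\<bar> < \<bar>f q\<bar>" if "q \<in> U" "x q \<in> cball (x p) r" for q
        using small[rule_format, OF that(2)] r(2)[OF that(2)] chart_inverse[OF c(1) that(1)] by simp
      have "f q + d t q = 0 \<longleftrightarrow> f q + (1 - \<rho> q) * d t q = 0" for q
      proof (cases "\<rho> q = 0")
        case False
        then have "\<bar>d t q\<bar> < \<bar>f q\<bar>" using nz \<rho>(8) by blast
        moreover have "\<bar>(1 - \<rho> q) * d t q\<bar> \<le> \<bar>d t q\<bar>"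
          using \<rho>(2)[of q] \<rho>(3)[of q] by (simp add: abs_mult mult_left_le_one_le)
        ultimately show ?thesis by linarith
      qed simp
      then have "nodal_set (\<lambda>q. f q + d t q) = nodal_set (\<lambda>q. f q + (1 - \<rho> q) * d t q)"
        unfolding nodal_set_def by blast
      moreover have "f q + d t q \<noteq> 0" if "q \<in> W" for q
      proof -
        have "q \<in> U" "x q \<in> cball (x p) r" using \<rho>(7) that by auto
        from nz[OF this] show ?thesis by linarith
      qed
      ultimately show "?good t"
        using invertibly_isotopic_refl by simp
    qed
  qed (use \<rho> in auto)
  then show thesis using \<rho>(5) that by blast
qed

text \<open>The slide applies with u = f + d and w = \<rho> d in coordinates. The hypothesis
  concerns the derivative alone; continuity spreads it to a ball, and C^1-smallness keeps it for f +
  d.\<close>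

lemma correction_at_regular_zero:
  assumes f: "smooth_fun A f" and c: "(U, x) \<in> A" "p \<in> U"
    and v0: "frechet_derivative (\<lambda>\<xi>. f (inv_into U x \<xi>)) (at (x p)) v0 \<noteq> 0"
  obtains W \<rho> where "correction_at f W \<rho>" "p \<in> W"
proof -
  let ?f = "\<lambda>\<xi>. f (inv_into U x \<xi>)"
  let ?L = "frechet_derivative ?f (at (x p))"
  note sf = smooth_fun_chart[OF f c(1)]
  have lin: "linear ?L"
    using c(2) by (intro linear_frechet_derivative smooth_on_differentiable[OF sf]) auto
  have "v0 \<noteq> 0" using v0 linear_0[OF lin] by auto
  \<comment> \<open>Normalised to length 1, with the sign chosen so that the derivative of
    \<open>f\<close> along \<open>v\<close> is positive.\<close>
  define v where "v = (sgn (?L v0) / norm v0) *\<^sub>R v0"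
  have v: "norm v = 1" using \<open>v0 \<noteq> 0\<close> v0 by (simp add: v_def abs_sgn_eq)
  have "?L v = \<bar>?L v0\<bar> / norm v0" unfolding v_def by (simp add: linear_scale[OF lin] abs_sgn mult.commute)
  then have Lv: "?L v > 0" using v0 \<open>v0 \<noteq> 0\<close> by simp
  \<comment> \<open>Dividing by 5 makes \<open>4 * a < ?L v\<close> strict, so it persists on a
    ball. One \<open>a\<close> is given up to the derivative of \<open>d\<close>, which leaves the 3
    a that \<open>interpolation_isotopy\<close> asks for.\<close>
  define a where "a = ?L v / 5"
  have a: "a > 0" "4 * a < ?L v" using Lv by (auto simp: a_def)
  have "isCont (\<lambda>\<xi>. frechet_derivative ?f (at \<xi>) v) (x p)"
    using smooth_on_isCont[OF smooth_on_deriv[OF sf]] c(2) by blast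
  then have "((\<lambda>\<xi>. frechet_derivative ?f (at \<xi>) v) \<longlongrightarrow> ?L v) (nhds (x p))"
    by (simp add: isCont_def tendsto_nhds_iff)
  then have "\<forall>\<^sub>F \<xi> in nhds (x p). 4 * a < frechet_derivative ?f (at \<xi>) v"
    using a(2) by (rule order_tendstoD)
  moreover have "\<forall>\<^sub>F \<xi> in nhds (x p). \<xi> \<in> x ` U"
    using open_chart_range[OF c(1)] c(2) by (intro eventually_nhds_in_open) auto
  ultimately have "\<forall>\<^sub>F \<xi> in nhds (x p). 4 * a < frechet_derivative ?f (at \<xi>) v \<and> \<xi> \<in> x ` U"
    by (rule eventually_conj)
  then obtain R where R: "R > 0"
    "\<And>\<xi>. \<xi> \<in> cball (x p) R \<Longrightarrow> 4 * a < frechet_derivative ?f (at \<xi>) v \<and> \<xi> \<in> x ` U"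
    unfolding eventually_nhds_metric_le by (auto simp: dist_commute)
  have sub: "cball (x p) R \<subseteq> x ` U" using R(2) by blast
  \<comment> \<open>The bump lives in the ball of half the radius; the shell around it is the room
    for sliding.\<close>
  have R2: "R / 2 > 0" "cball (x p) (R / 2) \<subseteq> x ` U"
    using R(1) sub subset_cball[of "R / 2" R "x p"] by auto
  obtain \<rho> W where \<rho>: "smooth_fun A \<rho>" "\<And>q. 0 \<le> \<rho> q" "\<And>q. \<rho> q \<le> 1"
    "open W" "p \<in> W" "\<And>q. q \<in> W \<Longrightarrow> \<rho> q = 1" "W \<subseteq> {q \<in> U. x q \<in> cball (x p) (R / 2)}"
    "\<And>q. \<rho> q \<noteq> 0 \<Longrightarrow> q \<in> U \<and> x q \<in> cball (x p) (R / 2)"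
    by (rule chart_bump_exists[OF c R2]) blast
  define J where "J = {-1<..<2::real}"
  let ?B = "ball (x p) R"
  have B: "open ?B" "?B \<subseteq> x ` U" "cball (x p) (R / 2) \<subseteq> ?B" using sub R(1) ball_subset_cball by auto
  have "correction_at f W \<rho>"
    unfolding correction_at_def
  proof (intro conjI allI impI ballI)
    fix F :: "real filter" and d
    assume d: "C1_null d F" and smooth: "\<forall>\<^sub>F t in F. smooth_fun A (d t)"
    \<comment> \<open>\<open>a\<close> bounds the directional derivatives of \<open>d\<close> and of
      \<rho> d, and \<open>a * R / 8\<close> bounds \<rho> d itself; these are the tolerances of
      \<open>interpolation_isotopy\<close>.\<close>
    define \<epsilon> where "\<epsilon> = min a (a * R / 8)"
    have \<epsilon>: "\<epsilon> > 0" "\<epsilon> \<le> a" "\<epsilon> \<le> a * R / 8" using a(1) R(1) by (auto simp: \<epsilon>_def)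
    let ?good = "\<lambda>t. (\<forall>q\<in>W. f q + d t q = 0 \<longrightarrow> nondegenerate_at (\<lambda>q. f q + d t q) q) \<and>
      invertibly_isotopic (nodal_set (\<lambda>q. f q + d t q)) (nodal_set (\<lambda>q. f q + (1 - \<rho> q) * d t q))"
    show "\<forall>\<^sub>F t in F. ?good t"
      using smooth C1_nullD[OF d c(1) compact_cball sub \<epsilon>(1), of v]
        C1_nullD[OF C1_null_mult[OF d smooth \<rho>(1)] c(1) compact_cball sub \<epsilon>(1), of v]
    proof eventually_elim
      fix t assume dt: "smooth_fun A (d t)"
        and small: "\<forall>\<xi>\<in>cball (x p) R. \<bar>d t (inv_into U x \<xi>)\<bar> < \<epsilon> \<and>
          \<bar>frechet_derivative (\<lambda>\<xi>. d t (inv_into U x \<xi>)) (at \<xi>) v\<bar> < \<epsilon>"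
        and small': "\<forall>\<xi>\<in>cball (x p) R. \<bar>\<rho> (inv_into U x \<xi>) * d t (inv_into U x \<xi>)\<bar> < \<epsilon> \<and>
          \<bar>frechet_derivative (\<lambda>\<xi>. \<rho> (inv_into U x \<xi>) * d t (inv_into U x \<xi>)) (at \<xi>) v\<bar> < \<epsilon>"
      let ?u = "\<lambda>\<xi>. f (inv_into U x \<xi>) + d t (inv_into U x \<xi>)"
      let ?w = "\<lambda>\<xi>. \<rho> (inv_into U x \<xi>) * d t (inv_into U x \<xi>)"
      note sd = smooth_fun_chart[OF dt c(1)]
      have Du: "3 * a \<le> frechet_derivative ?u (at \<xi>) v" if "\<xi> \<in> ?B" for \<xi>
      proof -
        have m: "\<xi> \<in> x ` U" "\<xi> \<in> cball (x p) R" using that B(2) by auto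
        have "frechet_derivative ?u (at \<xi>) = (\<lambda>v. frechet_derivative ?f (at \<xi>) v +
            frechet_derivative (\<lambda>\<xi>. d t (inv_into U x \<xi>)) (at \<xi>) v)"
          by (rule frechet_derivative_at[OF has_derivative_add[OF
                smooth_on_has_derivative[OF sf m(1)] smooth_on_has_derivative[OF sd m(1)]], symmetric])
        then show ?thesis
          using small[rule_format, OF m(2)] R(2)[OF m(2)] \<epsilon>(2) by (simp add: abs_less_iff)
      qed
      have w0: "?w \<xi> = 0" if "\<xi> \<in> ?B" "\<xi> \<notin> cball (x p) (R / 2)" for \<xi>
      proof -
        have "x (inv_into U x \<xi>) = \<xi>" using that(1) B(2) chart_apply_inverse[OF c(1)] by blast
        then have "\<rho> (inv_into U x \<xi>) = 0" using \<rho>(8) that(2) by metis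
        then show ?thesis by simp
      qed
      obtain \<eta> \<theta> where \<eta>\<theta>: "smooth_on (J \<times> ?B) \<eta>" "smooth_on (J \<times> ?B) \<theta>"
        "\<And>s \<xi>. s \<in> J \<Longrightarrow> \<xi> \<in> ?B \<Longrightarrow> \<eta> (s, \<xi>) \<in> ?B \<and> \<theta> (s, \<xi>) \<in> ?B"
        "\<And>s \<xi>. s \<in> J \<Longrightarrow> \<xi> \<in> ?B \<Longrightarrow> \<theta> (s, \<eta> (s, \<xi>)) = \<xi> \<and> \<eta> (s, \<theta> (s, \<xi>)) = \<xi>"
        "\<And>s \<xi>. s \<in> J \<Longrightarrow> \<xi> \<in> ?B \<Longrightarrow> ?u (\<eta> (s, \<xi>)) - s * ?w (\<eta> (s, \<xi>)) = ?u \<xi>"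
        "\<And>s \<xi>. s \<in> J \<Longrightarrow> \<xi> \<in> ?B \<Longrightarrow> s * ?w \<xi> = 0 \<Longrightarrow> \<eta> (s, \<xi>) = \<xi> \<and> \<theta> (s, \<xi>) = \<xi>"
      proof (rule interpolation_isotopy[OF R(1) v a(1), of "x p" ?u ?w, folded J_def])
        show "smooth_on ?B ?u"
          by (intro smooth_on_add open_ball smooth_on_subset[OF sf] smooth_on_subset[OF sd] B(2))
        show "smooth_on ?B ?w"
          by (rule smooth_on_subset[OF smooth_fun_chart[OF smooth_fun_mult[OF \<rho>(1) dt] c(1)] B(2)])
        show "\<bar>frechet_derivative ?w (at \<xi>) v\<bar> \<le> a" "\<bar>?w \<xi>\<bar> \<le> a * R / 8" if "\<xi> \<in> ?B" for \<xi>
          using small'[rule_format, of \<xi>] that \<epsilon>(2,3) by auto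
      qed (use Du w0 in blast)+
      have J: "open J" "0 \<in> J" "1 \<in> J" by (auto simp: J_def)
      define H G where "H = extend_by_id U x ?B \<eta>" and "G = extend_by_id U x ?B \<theta>"
      have fam: "smooth_map_family A J H" "smooth_map_family A J G"
        unfolding H_def G_def using \<eta>\<theta>(3,6) w0
        by (auto intro!: smooth_map_family_extend_by_id[OF J(1) c(1) B(1,2) compact_cball B(3)] \<eta>\<theta>(1,2))
      have box: "x (H s q) = \<eta> (s, x q) \<and> H s q \<in> U \<and> H s q = inv_into U x (\<eta> (s, x q))"
        "x (G s q) = \<theta> (s, x q) \<and> G s q \<in> U \<and> G s q = inv_into U x (\<theta> (s, x q))"
        if "s \<in> J" "q \<in> U" "x q \<in> ?B" for s q
      proof -
        have "\<eta> (s, x q) \<in> x ` U" "\<theta> (s, x q) \<in> x ` U" using \<eta>\<theta>(3)[OF that(1,3)] B(2) by auto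
        then show "x (H s q) = \<eta> (s, x q) \<and> H s q \<in> U \<and> H s q = inv_into U x (\<eta> (s, x q))"
          "x (G s q) = \<theta> (s, x q) \<and> G s q \<in> U \<and> G s q = inv_into U x (\<theta> (s, x q))"
          using that chart_apply_inverse[OF c(1)] chart_inverse_mem[OF c(1)]
          by (auto simp: H_def G_def extend_by_id_def)
      qed
      have out: "H s q = q" "G s q = q" if "\<not> (q \<in> U \<and> x q \<in> ?B)" for s q
        using that by (auto simp: H_def G_def extend_by_id_def)
      have inv: "G s (H s q) = q \<and> H s (G s q) = q" if "s \<in> J" for s q
      proof (cases "q \<in> U \<and> x q \<in> ?B")
        case True
        then have q: "q \<in> U" "x q \<in> ?B" by auto
        have h: "x (H s q) = \<eta> (s, x q)" "H s q \<in> U"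
          and g: "x (G s q) = \<theta> (s, x q)" "G s q \<in> U"
          using box[OF that q] by blast+
        have hg: "x (H s q) \<in> ?B" "x (G s q) \<in> ?B"
          unfolding h(1) g(1) using \<eta>\<theta>(3)[OF that q(2)] by blast+
        have "G s (H s q) = inv_into U x (\<theta> (s, x (H s q)))"
          and "H s (G s q) = inv_into U x (\<eta> (s, x (G s q)))"
          using box(2)[OF that h(2) hg(1)] box(1)[OF that g(2) hg(2)] by blast+
        then show ?thesis
          using h(1) g(1) \<eta>\<theta>(4)[OF that q(2)] chart_inverse[OF c(1) q(1)] by simp
      qed (simp add: out)
      have H0: "H 0 = id"
      proof
        fix q
        show "H 0 q = id q"
          using box(1)[OF J(2), of q] \<eta>\<theta>(6)[OF J(2), of "x q"] chart_inverse[OF c(1), of q] out(1)[of q 0]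
          by (cases "q \<in> U \<and> x q \<in> ?B") auto
      qed
      \<comment> \<open>\<open>H 1\<close> transports the whole function, at every level and on all
        of the manifold. Applied at \<open>G 1 q\<close>, this also shows that every zero of the
        corrected function is reached.\<close>
      have conj: "f (H 1 q) + (1 - \<rho> (H 1 q)) * d t (H 1 q) = f q + d t q" for q
      proof (cases "q \<in> U \<and> x q \<in> ?B")
        case True
        then show ?thesis
          using box(1)[OF J(3), of q] \<eta>\<theta>(5)[OF J(3), of "x q"] chart_inverse[OF c(1), of q]
          by (simp add: algebra_simps)
      next
        case False
        then have "\<rho> q = 0" using \<rho>(8)[of q] B(3) by blast
        then show ?thesis using out(1)[OF False] by simp
      qed
      have "H 1 ` nodal_set (\<lambda>q. f q + d t q) = nodal_set (\<lambda>q. f q + (1 - \<rho> q) * d t q)"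
      proof (intro set_eqI iffI)
        fix q assume "q \<in> nodal_set (\<lambda>q. f q + (1 - \<rho> q) * d t q)"
        then have "G 1 q \<in> nodal_set (\<lambda>q. f q + d t q)"
          using conj[of "G 1 q"] inv[OF J(3), of q] by (simp add: nodal_set_def)
        then show "q \<in> H 1 ` nodal_set (\<lambda>q. f q + d t q)"
          using inv[OF J(3), of q] by (metis image_eqI)
      qed (use conj in \<open>auto simp: nodal_set_def\<close>)
      then have "invertibly_isotopic (nodal_set (\<lambda>q. f q + d t q))
             (nodal_set (\<lambda>q. f q + (1 - \<rho> q) * d t q))"
        unfolding invertibly_isotopic_def J_def[symmetric]
        using fam inv H0 by (intro exI[of _ H] exI[of _ G]) (auto simp: fun_eq_iff)
      moreover have "nondegenerate_at (\<lambda>q. f q + d t q) q"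
        if "q \<in> W" for q
      proof -
        have q: "q \<in> U" "x q \<in> ?B" using that \<rho>(7) B(3) by blast+
        have "frechet_derivative ?u (at (x q)) v \<noteq> 0" using Du[OF q(2)] a(1) by linarith
        then show ?thesis unfolding nondegenerate_at_def using c(1) q(1) by blast
      qed
      ultimately show "?good t" by blast
    qed
  qed (use \<rho> in auto)
  then show thesis using \<rho>(5) that by blast
qed

section \<open>From local corrections to stability\<close>

text \<open>The derivative lists \<open>[]\<close> and \<open>[v]\<close> give the two bounds;
  smoothness identifies the derivative of the difference with the difference of the
  derivatives.\<close>

lemma smooth_convergence_imp_C1_null:
  assumes conv: "smooth_convergence A \<phi> f F" and smooth: "\<forall>\<^sub>F t in F. smooth_fun A (\<phi> t)"
    and f: "smooth_fun A f"
  shows "C1_null (\<lambda>t p. \<phi> t p - f p) F"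
  unfolding C1_null_def
proof (intro allI impI)
  fix U x K v and \<epsilon> :: real
  assume c: "(U, x) \<in> A" and K: "compact K" "K \<subseteq> x ` U" and \<epsilon>: "\<epsilon> > 0"
  let ?f = "\<lambda>\<xi>. f (inv_into U x \<xi>)" and ?\<phi> = "\<lambda>t \<xi>. \<phi> t (inv_into U x \<xi>)"
  have rep: "local_rep (U, x) u = (\<lambda>\<xi>. u (inv_into U x \<xi>))" for u :: "'m \<Rightarrow> real" by auto
  have lim: "uniform_limit K (\<lambda>t. iter_deriv vs (?\<phi> t)) (iter_deriv vs ?f) F" for vs
    using conv c K unfolding smooth_convergence_def rep[symmetric] by blast
  from uniform_limitD[OF lim[of "[]"] \<epsilon>] uniform_limitD[OF lim[of "[v]"] \<epsilon>] smooth
  show "\<forall>\<^sub>F t in F. \<forall>\<xi>\<in>K. \<bar>?\<phi> t \<xi> - ?f \<xi>\<bar> < \<epsilon> \<and>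
      \<bar>frechet_derivative (\<lambda>\<xi>. ?\<phi> t \<xi> - ?f \<xi>) (at \<xi>) v\<bar> < \<epsilon>"
  proof eventually_elim
    case (elim t)
    show ?case
    proof
      fix \<xi> assume \<xi>: "\<xi> \<in> K"
      then have m: "\<xi> \<in> x ` U" using K by blast
      have "frechet_derivative (\<lambda>\<xi>. ?\<phi> t \<xi> - ?f \<xi>) (at \<xi>) =
          (\<lambda>v. frechet_derivative (?\<phi> t) (at \<xi>) v - frechet_derivative ?f (at \<xi>) v)"
        by (rule frechet_derivative_at[OF has_derivative_diff[OF
              smooth_on_has_derivative[OF smooth_fun_chart[OF elim(3) c] m]
              smooth_on_has_derivative[OF smooth_fun_chart[OF f c] m]], symmetric])
      then show "\<bar>?\<phi> t \<xi> - ?f \<xi>\<bar> < \<epsilon> \<and>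
          \<bar>frechet_derivative (\<lambda>\<xi>. ?\<phi> t \<xi> - ?f \<xi>) (at \<xi>) v\<bar> < \<epsilon>"
        using elim(1,2) \<xi> by (simp add: dist_real_def)
    qed
  qed
qed

text \<open>By the chain rule through the transition map, a derivative that is nonzero in one chart
  is nonzero in every other. A nonzero linear functional to the reals is onto.\<close>

lemma regular_valueI:
  assumes u: "smooth_fun A u"
    and nz: "\<And>q. u q = c \<Longrightarrow> nondegenerate_at u q"
  shows "regular_value A u c"
proof -
  have "surj (frechet_derivative (local_rep (V, y) u) (at (y q)))"
    if q: "u q = c" and V: "(V, y) \<in> A" "q \<in> V" for q V y
  proof -
    obtain U x v where U: "(U, x) \<in> A" "q \<in> U"
      and v: "frechet_derivative (\<lambda>\<xi>. u (inv_into U x \<xi>)) (at (x q)) v \<noteq> 0"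
      using nz[OF q] unfolding nondegenerate_at_def by auto
    let ?uU = "\<lambda>\<xi>. u (inv_into U x \<xi>)" and ?uV = "\<lambda>\<xi>. u (inv_into V y \<xi>)"
    let ?T = "\<lambda>\<xi>. y (inv_into U x \<xi>)"
    have N: "open (x ` (U \<inter> V))" "x q \<in> x ` (U \<inter> V)"
      using open_chart_image[OF U(1)] open_chart_domain[OF U(1)] open_chart_domain[OF V(1)] U(2) V(2)
      by (auto simp: open_Int)
    have "(?T has_derivative frechet_derivative ?T (at (x q))) (at (x q))"
      by (rule smooth_on_has_derivative[OF smooth_on_transition[OF U(1) V(1)] N(2)])
    moreover have L: "(?uV has_derivative frechet_derivative ?uV (at (y q))) (at (y q))"
      using smooth_on_has_derivative[OF smooth_fun_chart[OF u V(1)]] V(2) by blast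
    then have "(?uV has_derivative frechet_derivative ?uV (at (y q))) (at (?T (x q)))"
      by (simp add: chart_inverse[OF U])
    ultimately have "((\<lambda>\<xi>. ?uV (?T \<xi>)) has_derivative
        (\<lambda>w. frechet_derivative ?uV (at (y q)) (frechet_derivative ?T (at (x q)) w))) (at (x q))"
      by (rule has_derivative_compose)
    from frechet_derivative_at[OF this]
    have "frechet_derivative ?uU (at (x q)) =
        (\<lambda>w. frechet_derivative ?uV (at (y q)) (frechet_derivative ?T (at (x q)) w))"
      using frechet_derivative_cong_open[OF N, of ?uU "\<lambda>\<xi>. ?uV (?T \<xi>)"]
      by (simp add: chart_image_Int_iff[OF U(1)] chart_inverse[OF V(1)])
    with v have "frechet_derivative ?uV (at (y q)) (frechet_derivative ?T (at (x q)) v) \<noteq> 0" by simp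
    then obtain w where w: "frechet_derivative ?uV (at (y q)) w \<noteq> 0" by blast
    have "frechet_derivative ?uV (at (y q)) ((r / frechet_derivative ?uV (at (y q)) w) *\<^sub>R w) = r" for r
      using w by (simp add: linear_scale[OF has_derivative_linear[OF L]])
    then have "surj (frechet_derivative ?uV (at (y q)))" by (rule surjI)
    then show ?thesis
      by (simp add: local_rep_def comp_def)
  qed
  then show ?thesis unfolding regular_value_def by blast
qed

lemma correction_exists:
  assumes f: "smooth_fun A f" and reg: "regular_value A f 0"
  shows "\<exists>W \<rho>. correction_at f W \<rho> \<and> p \<in> W"
proof (cases "f p = 0")
  case True
  obtain U x where c: "(U, x) \<in> A" "p \<in> U" by (rule chart_cover)
  have "surj (frechet_derivative (local_rep (U, x) f) (at (x p)))"
    using reg True c unfolding regular_value_def by blast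
  then have "surj (frechet_derivative (\<lambda>\<xi>. f (inv_into U x \<xi>)) (at (x p)))"
    by (simp add: local_rep_def comp_def)
  then obtain v where "1 = frechet_derivative (\<lambda>\<xi>. f (inv_into U x \<xi>)) (at (x p)) v"
    by (rule surjE)
  then have "frechet_derivative (\<lambda>\<xi>. f (inv_into U x \<xi>)) (at (x p)) v \<noteq> 0" by simp
  from correction_at_regular_zero[OF f c this] show ?thesis by blast
next
  case False
  from correction_at_nonzero[OF f this] show ?thesis by blast
qed

text \<open>The induction varies \<open>d\<close>: after the first bump the perturbation is (1 -
  \<rho>) d, which is again C^1-null, and the remaining corrections act on it. Only finitely many
  eventual statements are combined.\<close>

lemma successive_corrections:
  fixes F :: "real filter"
  assumes "\<And>\<rho>. \<rho> \<in> set \<rho>s \<Longrightarrow> \<exists>W. correction_at f W \<rho>"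
    and "C1_null d F" "\<forall>\<^sub>F t in F. smooth_fun A (d t)"
  shows "\<forall>\<^sub>F t in F. invertibly_isotopic (nodal_set (\<lambda>q. f q + d t q))
           (nodal_set (\<lambda>q. f q + prod_list (map (\<lambda>\<rho>. 1 - \<rho> q) \<rho>s) * d t q))"
  using assms
proof (induction \<rho>s arbitrary: d)
  case Nil
  then show ?case by (simp add: invertibly_isotopic_refl)
next
  case (Cons \<rho> \<rho>s)
  obtain W where \<rho>: "correction_at f W \<rho>" using Cons.prems(1) by auto
  have s: "smooth_fun A (\<lambda>q. 1 - \<rho> q)"
    using \<rho> by (intro smooth_fun_diff smooth_fun_const) (simp add: correction_at_def)
  have first: "\<forall>\<^sub>F t in F. invertibly_isotopic (nodal_set (\<lambda>q. f q + d t q))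
      (nodal_set (\<lambda>q. f q + (1 - \<rho> q) * d t q))"
    by (rule correction_atD(2)[OF \<rho> Cons.prems(2,3)])
  have "\<forall>\<^sub>F t in F. smooth_fun A (\<lambda>q. (1 - \<rho> q) * d t q)"
    using Cons.prems(3) by (rule eventually_mono) (rule smooth_fun_mult[OF s])
  with C1_null_mult[OF Cons.prems(2,3) s]
  have "\<forall>\<^sub>F t in F. invertibly_isotopic (nodal_set (\<lambda>q. f q + (1 - \<rho> q) * d t q))
      (nodal_set (\<lambda>q. f q + prod_list (map (\<lambda>\<rho>. 1 - \<rho> q) \<rho>s) * ((1 - \<rho> q) * d t q)))"
    using Cons.prems(1) by (intro Cons.IH) auto
  with first show ?case
    by eventually_elim (drule (1) invertibly_isotopic_trans, simp add: mult_ac)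
qed

lemma nodal_stability:
  fixes \<phi> :: "real \<Rightarrow> 'm \<Rightarrow> real"
  assumes compact: "compact (UNIV :: 'm set)"
    and smooth: "\<And>t. t \<in> I \<Longrightarrow> smooth_fun A (\<phi> t)" and f: "smooth_fun A f"
    and conv: "smooth_convergence A \<phi> f (at 0 within I)" and reg: "regular_value A f 0"
  shows "\<forall>\<^sub>F t in at 0 within I.
    regular_value A (\<phi> t) 0 \<and> invertibly_isotopic (nodal_set (\<phi> t)) (nodal_set f)"
proof -
  let ?F = "at (0::real) within I"
  have inI: "\<forall>\<^sub>F t in ?F. t \<in> I" by (simp add: eventually_at_filter)
  then have smooth_ev: "\<forall>\<^sub>F t in ?F. smooth_fun A (\<phi> t)" by (rule eventually_mono) (rule smooth)
  define d where "d t q = \<phi> t q - f q" for t q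
  have d: "C1_null d ?F"
    unfolding d_def[abs_def] by (rule smooth_convergence_imp_C1_null[OF conv smooth_ev f])
  have d_smooth: "\<forall>\<^sub>F t in ?F. smooth_fun A (d t)"
    using smooth_ev unfolding d_def[abs_def] by (rule eventually_mono) (rule smooth_fun_diff[OF _ f])
  obtain W \<rho> where W: "\<And>p. correction_at f (W p) (\<rho> p) \<and> p \<in> W p"
    using correction_exists[OF f reg] by metis
  have "\<And>p. open (W p)" using W by (simp add: correction_at_def)
  moreover have "UNIV \<subseteq> (\<Union>p\<in>UNIV. W p)" using W by blast
  ultimately obtain C where C: "finite C" "UNIV \<subseteq> (\<Union>p\<in>C. W p)"
    using compactE_image[OF compact, of UNIV W] by auto
  obtain ps where ps: "set ps = C" using finite_list[OF C(1)] by blast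
  have "\<forall>\<^sub>F t in ?F. invertibly_isotopic (nodal_set (\<lambda>q. f q + d t q))
      (nodal_set (\<lambda>q. f q + prod_list (map (\<lambda>\<rho>. 1 - \<rho> q) (map \<rho> ps)) * d t q))"
    using W by (intro successive_corrections[OF _ d d_smooth]) auto
  \<comment> \<open>Every point lies in some \<open>W p\<close> of the finite subcover, where one
    factor is 0. The last function of the chain is therefore \<open>f\<close> itself.\<close>
  moreover have "prod_list (map (\<lambda>\<rho>. 1 - \<rho> q) (map \<rho> ps)) = 0" for q
  proof -
    obtain p where "p \<in> C" "q \<in> W p" using C(2) by blast
    then have "1 - \<rho> p q = 0" using W[of p] by (simp add: correction_at_def)
    then show ?thesis using \<open>p \<in> C\<close> ps by (force simp: prod_list_zero_iff)
  qed
  ultimately have iso: "\<forall>\<^sub>F t in ?F. invertibly_isotopic (nodal_set (\<phi> t)) (nodal_set f)"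
    by (simp add: d_def)
  have "\<forall>\<^sub>F t in ?F. \<forall>q\<in>W p. f q + d t q = 0 \<longrightarrow>
      nondegenerate_at (\<lambda>q. f q + d t q) q" for p
    by (rule correction_atD(1)[OF conjunct1[OF W] d d_smooth])
  then have "\<forall>\<^sub>F t in ?F. \<forall>p\<in>C. \<forall>q\<in>W p. \<phi> t q = 0 \<longrightarrow> nondegenerate_at (\<phi> t) q"
    using C(1) by (intro eventually_ball_finite) (auto simp: d_def)
  with smooth_ev have "\<forall>\<^sub>F t in ?F. regular_value A (\<phi> t) 0"
  proof eventually_elim
    case (elim t)
    show ?case by (rule regular_valueI[OF elim(1)]) (use elim(2) C(2) in blast)
  qed
  then show ?thesis using iso by (rule eventually_conj)
qed

end

theorem proposition6p1:
  fixes A :: "('m::t2_space, 'n::finite) chart set"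
    and I :: "real set"
    and g :: "real \<Rightarrow> ('m, 'n) metric"
    and V :: "real \<Rightarrow> 'm \<Rightarrow> real"
    and \<phi> :: "real \<Rightarrow> 'm \<Rightarrow> real"
  assumes "closed_manifold A"
    and "open I" and "is_interval I" and "0 \<in> I"
    and "smooth_metric_family A I g"
    and "smooth_fun_family A I V"
    and "\<And>t. t \<in> I \<Longrightarrow> schroedinger_eigenfunction A (g t) (V t) (\<phi> t)"
    and "smooth_convergence A \<phi> (\<phi> 0) (at 0 within I)"
    and "regular_value A (\<phi> 0) 0"
  shows "\<exists>\<delta>>0. \<forall>t\<in>I. \<bar>t\<bar> < \<delta> \<longrightarrow>
           regular_value A (\<phi> t) 0 \<and>
           ambiently_isotopic A (nodal_set (\<phi> t)) (nodal_set (\<phi> 0)) \<and>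
           nodal_count (\<phi> t) = nodal_count (\<phi> 0)"
proof -
  interpret smooth_manifold A
    using assms(1) by unfold_locales (simp add: closed_manifold_def)
  have smooth: "smooth_fun A (\<phi> t)" if "t \<in> I" for t
    using assms(7)[OF that] by (simp add: schroedinger_eigenfunction_def)
  have compact: "compact (UNIV :: 'm set)" using assms(1) by (simp add: closed_manifold_def)
  obtain \<delta> where \<delta>: "\<delta> > 0" "\<And>t. t \<in> I \<Longrightarrow> t \<noteq> 0 \<Longrightarrow> \<bar>t\<bar> < \<delta> \<Longrightarrow>
      regular_value A (\<phi> t) 0 \<and> invertibly_isotopic (nodal_set (\<phi> t)) (nodal_set (\<phi> 0))"
    using nodal_stability[OF compact smooth smooth[OF assms(4)] assms(8,9)]
    unfolding eventually_at by auto
  \<comment> \<open>The filter \<open>at 0 within I\<close> says nothing about t = 0; there the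
    assumption on \<open>\<phi> 0\<close> and reflexivity of the isotopy relation apply.\<close>
  have "regular_value A (\<phi> t) 0 \<and> invertibly_isotopic (nodal_set (\<phi> t)) (nodal_set (\<phi> 0))"
    if "t \<in> I" "\<bar>t\<bar> < \<delta>" for t
    using \<delta>(2)[OF that(1) _ that(2)] assms(9) invertibly_isotopic_refl by (cases "t = 0") auto
  then show ?thesis
    using \<delta>(1) invertibly_isotopic_imp_ambiently_isotopic invertibly_isotopic_nodal_count by blast
qed

end
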